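(* For every graph $H$ with $i$ isolated vertices and $q$ edges, every graph $G$ with average degree at least $i+6.929q$ contains $H$ as a minor.
   Context: All graphs are finite and simple. A graph $H$ is a minor of $G$ if a graph isomorphic to $H$ can be obtained from a subgraph of $G$ by contracting edges. *)

theory Defs
  imports Complex_Main
begin

definition graph :: "'a set \<Rightarrow> 'a set set \<Rightarrow> bool" where
  "graph V E \<longleftrightarrow> finite V \<and> (\<forall>e\<in>E. e \<subseteq> V \<and> card e = 2)"

definition degree :: "'a set set \<Rightarrow> 'a \<Rightarrow> nat" where
  "degree E v = card {e \<in> E. v \<in> e}"

definition average_degree :: "'a set \<Rightarrow> 'a set set \<Rightarrow> real" where
  "average_degree V E = real (\<Sum>v\<in>V. degree E v) / real (card V)"

definition isolated_vertices :: "'a set \<Rightarrow> 'a set set \<Rightarrow> 'a set" where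
  "isolated_vertices V E = {v \<in> V. \<forall>e\<in>E. v \<notin> e}"

definition subgraph :: "'a set \<Rightarrow> 'a set set \<Rightarrow> 'a set \<Rightarrow> 'a set set \<Rightarrow> bool" where
  "subgraph V' E' V E \<longleftrightarrow> V' \<subseteq> V \<and> E' \<subseteq> E \<and> graph V' E'"

definition contract_edge :: "'a set \<times> 'a set set \<Rightarrow> 'a \<Rightarrow> 'a \<Rightarrow> 'a set \<times> 'a set set" where
  "contract_edge G u v =
     (fst G - {v},
      {e'. \<exists>e\<in>snd G. e' = (\<lambda>x. if x = v then u else x) ` e \<and> card e' = 2})"

inductive contracts_to :: "'a set \<times> 'a set set \<Rightarrow> 'a set \<times> 'a set set \<Rightarrow> bool" where
  refl: "contracts_to G G"
| step: "\<lbrakk>{u, v} \<in> snd G; u \<noteq> v; contracts_to (contract_edge G u v) M\<rbrakk> \<Longrightarrow> contracts_to G M"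

definition graph_iso :: "'a set \<Rightarrow> 'a set set \<Rightarrow> 'b set \<Rightarrow> 'b set set \<Rightarrow> bool" where
  "graph_iso V E V' E' \<longleftrightarrow> (\<exists>f. bij_betw f V V' \<and> (\<lambda>e. f ` e) ` E = E')"

definition is_minor :: "'b set \<Rightarrow> 'b set set \<Rightarrow> 'a set \<Rightarrow> 'a set set \<Rightarrow> bool" where
  "is_minor VH EH VG EG \<longleftrightarrow>
     (\<exists>V' E' VM EM. subgraph V' E' VG EG \<and> contracts_to (V', E') (VM, EM) \<and> graph_iso VM EM VH EH)"

end

theory Submission
  imports Defs "HOL-Combinatorics.Permutations"
begin

text \<open>
  Let \<open>H\<close> have \<open>i\<close> isolated vertices and \<open>q\<close> edges. Among the minors of \<open>G\<close> with average degree at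
  least \<open>2k = i + 6.929 q\<close> take one with fewest vertices: every edge lies in about \<open>k\<close> triangles, so the
  closed neighbourhood of a vertex of minimum degree has at most \<open>2k + 1\<close> vertices and minimum degree
  more than \<open>k\<close>. The tree components of \<open>H\<close> are embedded there greedily. What remains of \<open>H\<close> has at
  most as many vertices as edges, say \<open>q\<close> edges again. Following Mader, contract further as long as
  the potential \<open>y / q + ln y / 2 - 3 / 2 * ln h\<close> of the graph with \<open>h\<close> vertices and average degree
  \<open>y\<close> does not decrease. The process stops before the graph is as small as \<open>q\<close>, and then in the
  neighbourhood of a vertex of minimum degree non-adjacent vertices have many common neighbours. A
  random injection of \<open>H\<close> into that neighbourhood realises most edges directly, and the common
  neighbours suffice to subdivide the others.
\<close>

section \<open>Branch-set models\<close>

text \<open>The potential is the first integral of a threshold. To first order, let a vertex of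
  degree \<open>y\<close> have a neighbourhood of minimum degree \<open>\<tau>\<close>, and put
  \<open>d = 2 * \<tau> - y\<close>. A random injection into it misses about
  \<open>q * (y - \<tau>) / y\<close> edges, and non-adjacent vertices have about \<open>d\<close>
  common neighbours, of which \<open>q\<close> may be occupied. The repair succeeds once
  \<open>q * (y - \<tau>) / y \<le> d - q\<close>, that is,
  \<open>d \<ge> 3 * q * y / (2 * y + q)\<close>. Contracting an edge in \<open>\<tau>\<close>
  triangles lowers \<open>y\<close> by about \<open>d / h\<close>. If \<open>y\<close> falls exactly
  at the threshold rate, its derivative in \<open>ln h\<close> is
  \<open>3 * q * y / (2 * y + q)\<close>, and along the solutions
  \<open>y / q + ln y / 2 - 3 / 2 * ln h\<close> is constant. So a contraction that would decrease
  the potential certifies what the injection needs. For \<open>y \<le> q \<le> h\<close> the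
  potential is at most \<open>1 - ln q\<close>; the start, with \<open>h\<close> about
  \<open>2 * k\<close> and \<open>y\<close> about \<open>k = 3.4645 * q\<close>, has to exceed this
  value. Trees are split off because the count of common neighbours charges for every vertex of
  \<open>H\<close>, which is affordable only for at most \<open>q\<close> vertices.\<close>

definition rgraph :: "'a set \<Rightarrow> 'a rel \<Rightarrow> bool" where
  "rgraph V R \<longleftrightarrow> finite V \<and> R \<subseteq> V \<times> V \<and> sym R \<and> irrefl R"

text \<open>Each edge occurs in both orientations, so the cardinality of the relation is the degree
  sum, and the average degree is \<open>card R / card V\<close> without a factor 2.\<close>

definition edge_rel :: "'a set set \<Rightarrow> 'a rel" where
  "edge_rel E = {(a, b). {a, b} \<in> E}"

text \<open>Connectivity by cuts instead of paths: images and unions are handled by pulling a cut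
  back.\<close>

definition connected_in :: "'a rel \<Rightarrow> 'a set \<Rightarrow> bool" where
  "connected_in R S \<longleftrightarrow> S \<noteq> {} \<and>
     (\<forall>A. A \<subseteq> S \<and> A \<noteq> {} \<and> A \<noteq> S \<longrightarrow> (\<exists>a\<in>A. \<exists>b\<in>S - A. (a, b) \<in> R))"

text \<open>The branch sets of a minor, for the guest \<open>(U, Q)\<close> and the host
  \<open>(V, R)\<close>. The last clause does not restrict \<open>x\<close> and \<open>y\<close> to
  \<open>U\<close>; therefore \<open>Q \<subseteq> U \<times> U\<close> is carried along when models
  are composed or united.\<close>

definition model :: "('b \<Rightarrow> 'a set) \<Rightarrow> 'b set \<Rightarrow> 'b rel \<Rightarrow> 'a set \<Rightarrow> 'a rel \<Rightarrow> bool" where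
  "model B U Q V R \<longleftrightarrow>
     (\<forall>x\<in>U. B x \<subseteq> V \<and> connected_in R (B x)) \<and>
     (\<forall>x\<in>U. \<forall>y\<in>U. x \<noteq> y \<longrightarrow> B x \<inter> B y = {}) \<and>
     (\<forall>x y. (x, y) \<in> Q \<longrightarrow> (\<exists>a\<in>B x. \<exists>b\<in>B y. (a, b) \<in> R))"

lemma rgraph_edge_rel:
  assumes "graph V E" shows "rgraph V (edge_rel E)"
proof -
  have "a \<in> V \<and> b \<in> V \<and> a \<noteq> b" if "{a, b} \<in> E" for a b
    using assms that unfolding graph_def by force
  then show ?thesis
    using assms unfolding rgraph_def edge_rel_def graph_def
    by (auto simp: sym_def irrefl_def insert_commute)
qed

lemma connected_in_crossing:
  assumes "connected_in R S" "A \<subseteq> S" "A \<noteq> {}" "A \<noteq> S"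
  obtains a b where "a \<in> A" "b \<in> S" "b \<notin> A" "(a, b) \<in> R"
  using assms unfolding connected_in_def by blast

lemma connected_in_singleton: "connected_in R {a}"
  unfolding connected_in_def by auto

lemma connected_in_image:
  assumes "connected_in R S"
    and "\<And>a b. a \<in> S \<Longrightarrow> b \<in> S \<Longrightarrow> (a, b) \<in> R \<Longrightarrow> f a \<noteq> f b \<Longrightarrow> (f a, f b) \<in> R'"
  shows "connected_in R' (f ` S)"
  unfolding connected_in_def
proof (intro conjI allI impI)
  show "f ` S \<noteq> {}" using assms(1) by (auto simp: connected_in_def)
  fix A assume A: "A \<subseteq> f ` S \<and> A \<noteq> {} \<and> A \<noteq> f ` S"
  let ?A = "{s \<in> S. f s \<in> A}"
  have "?A \<subseteq> S" "?A \<noteq> {}" "?A \<noteq> S" using A by auto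
  then obtain a b where ab: "a \<in> ?A" "b \<in> S" "b \<notin> ?A" "(a, b) \<in> R"
    by (rule connected_in_crossing[OF assms(1)])
  then have "(f a, f b) \<in> R'" by (intro assms(2)) auto
  then show "\<exists>a\<in>A. \<exists>b\<in>f ` S - A. (a, b) \<in> R'" using ab by blast
qed

lemma connected_in_star:
  assumes "c \<in> S" "\<And>a. a \<in> S \<Longrightarrow> a \<noteq> c \<Longrightarrow> (a, c) \<in> R \<and> (c, a) \<in> R"
  shows "connected_in R S"
  unfolding connected_in_def
proof (intro conjI allI impI)
  show "S \<noteq> {}" using assms by auto
  fix A assume A: "A \<subseteq> S \<and> A \<noteq> {} \<and> A \<noteq> S"
  show "\<exists>a\<in>A. \<exists>b\<in>S - A. (a, b) \<in> R"
  proof (cases "c \<in> A")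
    case True
    then show ?thesis using A assms(2) by blast
  next
    case False
    then show ?thesis using A assms by blast
  qed
qed

text \<open>A cut of the union either splits some \<open>A t\<close>, whose own connectivity gives
  the edge, or consists of whole parts and induces a cut of \<open>T\<close>.\<close>

lemma connected_in_Union:
  assumes T: "connected_in Q T"
    and A: "\<And>t. t \<in> T \<Longrightarrow> connected_in R (A t)"
    and link: "\<And>s t. s \<in> T \<Longrightarrow> t \<in> T \<Longrightarrow> (s, t) \<in> Q \<Longrightarrow> \<exists>a\<in>A s. \<exists>b\<in>A t. (a, b) \<in> R"
  shows "connected_in R (\<Union>t\<in>T. A t)"
  unfolding connected_in_def
proof (intro conjI allI impI)
  obtain t where t: "t \<in> T" using T by (auto simp: connected_in_def)
  then have "A t \<noteq> {}" using A by (simp add: connected_in_def)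
  then show "(\<Union>t\<in>T. A t) \<noteq> {}" using t by blast
  fix X assume X: "X \<subseteq> (\<Union>t\<in>T. A t) \<and> X \<noteq> {} \<and> X \<noteq> (\<Union>t\<in>T. A t)"
  show "\<exists>a\<in>X. \<exists>b\<in>(\<Union>t\<in>T. A t) - X. (a, b) \<in> R"
  proof (cases "\<exists>t\<in>T. A t \<inter> X \<noteq> {} \<and> \<not> A t \<subseteq> X")
    case True
    then obtain t where t: "t \<in> T" "A t \<inter> X \<noteq> {}" "A t \<inter> X \<noteq> A t" by blast
    obtain a b where "a \<in> A t \<inter> X" "b \<in> A t" "b \<notin> A t \<inter> X" "(a, b) \<in> R"
      using connected_in_crossing[OF A[OF t(1)] _ t(2,3)] by blast
    then show ?thesis using t(1) by blast
  next
    case False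
    let ?Y = "{t \<in> T. A t \<subseteq> X}"
    obtain a t where "a \<in> X" "t \<in> T" "a \<in> A t" using X by blast
    then have "?Y \<noteq> {}" using False by blast
    moreover have "?Y \<noteq> T"
    proof
      assume "?Y = T"
      then have "(\<Union>t\<in>T. A t) \<subseteq> X" by blast
      then show False using X by blast
    qed
    ultimately obtain s t where st: "s \<in> ?Y" "t \<in> T" "t \<notin> ?Y" "(s, t) \<in> Q"
      by (rule connected_in_crossing[OF T Collect_subset])
    then obtain a b where ab: "a \<in> A s" "b \<in> A t" "(a, b) \<in> R" using link by blast
    have "b \<notin> X" using ab(2) st(2,3) False by blast
    then show ?thesis using ab st(1,2) by blast
  qed
qed

text \<open>Lets every reduction pass to a minor of the host and look for the guest there.\<close>

lemma model_trans:
  assumes B: "model B U Q W S" and A: "model A W S V R" and Q: "Q \<subseteq> U \<times> U"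
  shows "model (\<lambda>x. \<Union>w\<in>B x. A w) U Q V R"
  unfolding model_def
proof (intro conjI ballI allI impI)
  note B' = B[unfolded model_def] and A' = A[unfolded model_def]
  fix x assume x: "x \<in> U"
  then have sub: "B x \<subseteq> W" using B' by blast
  then show "(\<Union>w\<in>B x. A w) \<subseteq> V" using A' by blast
  show "connected_in R (\<Union>w\<in>B x. A w)"
  proof (rule connected_in_Union[of S])
    show "connected_in S (B x)" using B' x by blast
    show "connected_in R (A t)" if "t \<in> B x" for t using that sub A' by blast
    show "\<exists>a\<in>A s. \<exists>b\<in>A t. (a, b) \<in> R" if "(s, t) \<in> S" for s t
      using that A' by blast
  qed
next
  fix x y assume xy: "x \<in> U" "y \<in> U" "x \<noteq> y"
  have "a \<noteq> b \<and> a \<in> W \<and> b \<in> W" if "a \<in> B x" "b \<in> B y" for a b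
    using that xy B unfolding model_def by blast
  then show "(\<Union>w\<in>B x. A w) \<inter> (\<Union>w\<in>B y. A w) = {}"
    using A unfolding model_def by blast
next
  fix x y assume "(x, y) \<in> Q"
  then obtain a b where "a \<in> B x" "b \<in> B y" "(a, b) \<in> S"
    using B unfolding model_def by blast
  then show "\<exists>a\<in>\<Union>w\<in>B x. A w. \<exists>b\<in>\<Union>w\<in>B y. A w. (a, b) \<in> R"
    using A unfolding model_def by blast
qed

lemma model_mono:
  assumes "model B U Q W S" "W \<subseteq> V" "S \<subseteq> R"
  shows "model B U Q V R"
proof -
  have "connected_in R X" if "connected_in S X" for X
    using that assms(3) unfolding connected_in_def by (meson subsetD)
  then show ?thesis using assms unfolding model_def by (meson order_trans subsetD)
qed

lemma model_singletons:
  assumes "inj_on f U" "f ` U \<subseteq> V" "\<And>x y. (x, y) \<in> Q \<Longrightarrow> (f x, f y) \<in> R"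
  shows "model (\<lambda>x. {f x}) U Q V R"
  using assms unfolding model_def inj_on_def by (auto simp: connected_in_singleton)

lemma model_Un:
  assumes B: "model B U Q V R" and C: "model C U' Q' V' R" and disj: "V \<inter> V' = {}" "U \<inter> U' = {}"
    and Q: "Q \<subseteq> U \<times> U" "Q' \<subseteq> U' \<times> U'"
  shows "model (\<lambda>x. if x \<in> U then B x else C x) (U \<union> U') (Q \<union> Q') (V \<union> V') R"
  unfolding model_def
proof (intro conjI ballI allI impI)
  note B' = B[unfolded model_def] and C' = C[unfolded model_def]
  fix x assume x: "x \<in> U \<union> U'"
  show "(if x \<in> U then B x else C x) \<subseteq> V \<union> V'"
    using x B' C' by (cases "x \<in> U") auto
  show "connected_in R (if x \<in> U then B x else C x)"
    using x B' C' by auto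
next
  fix x y assume xy: "x \<in> U \<union> U'" "y \<in> U \<union> U'" "x \<noteq> y"
  have sub: "\<And>x. x \<in> U \<Longrightarrow> B x \<subseteq> V" "\<And>x. x \<in> U' \<Longrightarrow> C x \<subseteq> V'"
    using B C unfolding model_def by blast+
  show "(if x \<in> U then B x else C x) \<inter> (if y \<in> U then B y else C y) = {}"
  proof (cases "x \<in> U \<longleftrightarrow> y \<in> U")
    case True
    then show ?thesis using xy B C unfolding model_def by (cases "x \<in> U") auto
  next
    case False
    then have "x \<in> U \<and> y \<in> U' \<and> y \<notin> U \<or> x \<in> U' \<and> x \<notin> U \<and> y \<in> U" using xy by auto
    then show ?thesis using sub[of x] sub[of y] disj(1) by (elim disjE) (auto dest: subsetD)
  qed
next
  fix x y assume xy: "(x, y) \<in> Q \<union> Q'"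
  show "\<exists>a\<in>if x \<in> U then B x else C x. \<exists>b\<in>if y \<in> U then B y else C y. (a, b) \<in> R"
  proof (cases "(x, y) \<in> Q")
    case True
    then show ?thesis using B Q(1) unfolding model_def by auto
  next
    case False
    then have "(x, y) \<in> Q'" "x \<notin> U" "y \<notin> U" using xy Q(2) disj(2) by auto
    then show ?thesis using C unfolding model_def by auto
  qed
qed

text \<open>Induction on \<open>card V\<close>, with \<open>p\<close> naming the branch set of each
  vertex. While \<open>p\<close> is not injective, some fibre has two vertices and, being connected,
  contains an edge. Its contraction keeps one end in the fibre, so the same \<open>p\<close> serves
  the smaller graph. An injective \<open>p\<close> is the isomorphism.\<close>

lemma contracts_to_fibres:
  assumes "graph V E" "p ` V = U"
    and "\<And>x. x \<in> U \<Longrightarrow> connected_in (edge_rel E) {a \<in> V. p a = x}"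
    and "{p ` e |e. e \<in> E \<and> card (p ` e) = 2} = D"
  shows "\<exists>VM EM. contracts_to (V, E) (VM, EM) \<and> graph_iso VM EM U D"
  using assms
proof (induction "card V" arbitrary: V E rule: less_induct)
  case less
  note g = less.prems(1)[unfolded graph_def]
  show ?case
  proof (cases "inj_on p V")
    case True
    have "card (p ` e) = 2" if "e \<in> E" for e
      using g that inj_on_subset[OF True, of e] by (simp add: card_image)
    then have "(\<lambda>e. p ` e) ` E = D" using less.prems(4) by auto
    moreover have "bij_betw p V U" using True less.prems(2) by (simp add: bij_betw_def)
    ultimately have "graph_iso V E U D" unfolding graph_iso_def by blast
    then show ?thesis using contracts_to.refl by blast
  next
    case False
    then obtain u w where uw: "u \<in> V" "w \<in> V" "u \<noteq> w" "p u = p w" unfolding inj_on_def by blast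
    let ?S = "{a \<in> V. p a = p u}"
    have "connected_in (edge_rel E) ?S" using less.prems(2,3) uw by blast
    moreover have "{u} \<subseteq> ?S" "{u} \<noteq> {}" "{u} \<noteq> ?S" using uw by auto
    ultimately obtain a v where "a \<in> {u}" "v \<in> ?S" "v \<notin> {u}" "(a, v) \<in> edge_rel E"
      by (rule connected_in_crossing)
    then have v: "v \<in> V" "p v = p u" "v \<noteq> u" "{u, v} \<in> E" by (auto simp: edge_rel_def)
    define f where "f = (\<lambda>x. if x = v then u else x)"
    define E' where "E' = {e'. \<exists>e\<in>E. e' = f ` e \<and> card e' = 2}"
    have ce: "contract_edge (V, E) u v = (V - {v}, E')"
      unfolding contract_edge_def E'_def f_def by simp
    have pf: "p (f x) = p x" for x using v by (simp add: f_def)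
    have fV: "f x \<in> V - {v}" if "x \<in> V" for x using that v uw by (auto simp: f_def)
    have "card (V - {v}) < card V" using g v by (intro card_Diff1_less) auto
    moreover have "graph (V - {v}) E'"
      unfolding graph_def E'_def using g fV by (auto simp: subset_iff)
    moreover have "p ` (V - {v}) = U"
    proof -
      have "p ` V \<subseteq> p ` (V - {v})" using fV pf by (metis image_eqI image_subsetI)
      then show ?thesis using less.prems(2) by blast
    qed
    moreover have "connected_in (edge_rel E') {a \<in> V - {v}. p a = x}" if "x \<in> U" for x
    proof -
      have "{a \<in> V - {v}. p a = x} = f ` {a \<in> V. p a = x}"
      proof
        show "{a \<in> V - {v}. p a = x} \<subseteq> f ` {a \<in> V. p a = x}" by (force simp: f_def)
        show "f ` {a \<in> V. p a = x} \<subseteq> {a \<in> V - {v}. p a = x}" using fV pf by auto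
      qed
      moreover have "connected_in (edge_rel E') (f ` {a \<in> V. p a = x})"
      proof (rule connected_in_image[OF less.prems(3)[OF that]])
        fix a b assume "(a, b) \<in> edge_rel E" "f a \<noteq> f b"
        then show "(f a, f b) \<in> edge_rel E'"
          unfolding edge_rel_def E'_def by (auto intro!: bexI[of _ "{a, b}"])
      qed
      ultimately show ?thesis by simp
    qed
    moreover have "{p ` e |e. e \<in> E' \<and> card (p ` e) = 2} = D"
    proof -
      have pfi: "p ` f ` e = p ` e" for e using pf by (simp add: image_image)
      have "card (f ` e) = 2" if "e \<in> E" "card (p ` e) = 2" for e
      proof -
        have fin: "finite e" "card e = 2" using g that(1) finite_subset by blast+
        have "card (f ` e) \<le> 2" using card_image_le[OF fin(1), of f] fin by simp
        moreover have "card (p ` f ` e) \<le> card (f ` e)" using fin by (intro card_image_le) auto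
        ultimately show ?thesis using that pfi by simp
      qed
      then have "{p ` e |e. e \<in> E' \<and> card (p ` e) = 2} = {p ` e |e. e \<in> E \<and> card (p ` e) = 2}"
        unfolding E'_def using pfi by (auto; metis)
      then show ?thesis using less.prems(4) by simp
    qed
    ultimately obtain VM EM where "contracts_to (V - {v}, E') (VM, EM)" "graph_iso VM EM U D"
      using less.hyps by blast
    then show ?thesis using v ce contracts_to.step[of u v "(V, E)"] by (metis snd_conv)
  qed
qed

lemma model_imp_is_minor:
  assumes H: "graph VH EH" and G: "graph VG EG" and B: "model B VH (edge_rel EH) VG (edge_rel EG)"
  shows "is_minor VH EH VG EG"
proof -
  note B' = B[unfolded model_def]
  define V where "V = (\<Union>x\<in>VH. B x)"
  define p where "p a = (THE x. x \<in> VH \<and> a \<in> B x)" for a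
  have p: "p a = x" if "x \<in> VH" "a \<in> B x" for a x
    unfolding p_def using that B' by (intro the_equality) blast+
  \<comment> \<open>\<open>graph_iso\<close> demands equality of edge sets, so edges between the
    branch sets of non-adjacent vertices of \<open>H\<close> are removed before contracting. Edges
    inside a branch set, where \<open>p\<close> is constant, stay.\<close>
  define E where "E = {e \<in> EG. e \<subseteq> V \<and> (card (p ` e) = 2 \<longrightarrow> p ` e \<in> EH)}"
  have V: "V \<subseteq> VG" unfolding V_def using B' by blast
  have sub: "subgraph V E VG EG"
    unfolding subgraph_def graph_def E_def using G V finite_subset by (auto simp: graph_def)
  have fib: "{a \<in> V. p a = x} = B x" if "x \<in> VH" for x
    unfolding V_def using that p by auto
  have "\<exists>VM EM. contracts_to (V, E) (VM, EM) \<and> graph_iso VM EM VH EH"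
  proof (rule contracts_to_fibres)
    show "graph V E" using sub by (simp add: subgraph_def)
    have "B x \<noteq> {}" if "x \<in> VH" for x using that B' by (auto simp: connected_in_def)
    then show "p ` V = VH" unfolding V_def using p by (auto simp: image_iff) (metis ex_in_conv)
    show "connected_in (edge_rel E) {a \<in> V. p a = x}" if x: "x \<in> VH" for x
    proof -
      have "connected_in (edge_rel E) (id ` B x)"
      proof (rule connected_in_image)
        show "connected_in (edge_rel EG) (B x)" using B' x by blast
        fix a b assume ab: "a \<in> B x" "b \<in> B x" "(a, b) \<in> edge_rel EG"
        then have "p ` {a, b} = {x}" using p x by auto
        then have "card (p ` {a, b}) \<noteq> 2" by simp
        then show "(id a, id b) \<in> edge_rel E"
          using ab x unfolding edge_rel_def E_def V_def by auto
      qed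
      then show ?thesis using fib x by simp
    qed
    show "{p ` e |e. e \<in> E \<and> card (p ` e) = 2} = EH"
    proof
      show "{p ` e |e. e \<in> E \<and> card (p ` e) = 2} \<subseteq> EH" unfolding E_def by auto
      show "EH \<subseteq> {p ` e |e. e \<in> E \<and> card (p ` e) = 2}"
      proof
        fix h assume h: "h \<in> EH"
        then obtain x y where xy: "h = {x, y}" "x \<noteq> y" "x \<in> VH" "y \<in> VH"
          using H unfolding graph_def by (metis card_2_iff insert_subset)
        then obtain a b where ab: "a \<in> B x" "b \<in> B y" "{a, b} \<in> EG"
          using B' h unfolding edge_rel_def by blast
        then have "p ` {a, b} = h" using p xy by auto
        moreover have "{a, b} \<subseteq> V" using ab xy by (auto simp: V_def)
        ultimately show "h \<in> {p ` e |e. e \<in> E \<and> card (p ` e) = 2}"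
          using ab h xy unfolding E_def by (intro CollectI exI[of _ "{a, b}"]) auto
      qed
    qed
  qed
  then show ?thesis using sub unfolding is_minor_def by blast
qed

section \<open>Contraction-minimal minors\<close>

lemma rgraph_finite_rel: "rgraph V R \<Longrightarrow> finite R"
  unfolding rgraph_def by (meson finite_SigmaI finite_subset)

lemma rgraph_symD: "rgraph V R \<Longrightarrow> (a, b) \<in> R \<Longrightarrow> (b, a) \<in> R"
  unfolding rgraph_def by (meson symD)

lemma rgraph_neD: "rgraph V R \<Longrightarrow> (a, b) \<in> R \<Longrightarrow> a \<noteq> b"
  unfolding rgraph_def irrefl_def by auto

lemma rgraph_inD: "rgraph V R \<Longrightarrow> (a, b) \<in> R \<Longrightarrow> a \<in> V \<and> b \<in> V"
  unfolding rgraph_def by auto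

lemma rgraph_finite_nbrs: "rgraph V R \<Longrightarrow> finite (R `` {v})"
  using rgraph_finite_rel finite_Image by blast

lemma rgraph_restrict: "rgraph V R \<Longrightarrow> W \<subseteq> V \<Longrightarrow> rgraph W (R \<inter> W \<times> W)"
  unfolding rgraph_def by (auto simp: sym_def irrefl_def intro: finite_subset)

lemma card_rgraph_eq_sum:
  assumes "rgraph V R"
  shows "card R = (\<Sum>v\<in>V. card (R `` {v}))"
proof -
  have "R = Sigma V (\<lambda>v. R `` {v})" using assms unfolding rgraph_def by auto
  moreover have "card (Sigma V (\<lambda>v. R `` {v})) = (\<Sum>v\<in>V. card (R `` {v}))"
    using assms by (intro card_SigmaI) (auto simp: rgraph_finite_nbrs rgraph_def)
  ultimately show ?thesis by simp
qed

lemma card_nbrs_less: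
  assumes "rgraph V R" "v \<in> V"
  shows "card (R `` {v}) < card V"
proof -
  have "R `` {v} \<subset> V" using assms by (auto simp: rgraph_def irrefl_def)
  then show ?thesis using assms by (simp add: rgraph_def psubset_card_mono)
qed

lemma card_rgraph_le:
  assumes "rgraph V R"
  shows "card R \<le> card V * (card V - 1)"
proof -
  have "card (R `` {v}) \<le> card V - 1" if "v \<in> V" for v
    using card_nbrs_less[OF assms that] by simp
  then have "(\<Sum>v\<in>V. card (R `` {v})) \<le> (\<Sum>v\<in>V. card V - 1)" by (rule sum_mono)
  then show ?thesis using card_rgraph_eq_sum[OF assms] by simp
qed

lemma obtains_min_degree_vertex:
  assumes "rgraph V R" "V \<noteq> {}"
  obtains v where "v \<in> V" "card V * card (R `` {v}) \<le> card R"
proof -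
  have "finite V" using assms by (simp add: rgraph_def)
  then obtain v where v: "v \<in> V" "\<And>w. w \<in> V \<Longrightarrow> card (R `` {v}) \<le> card (R `` {w})"
    using assms(2) arg_min_if_finite[of V "\<lambda>v. card (R `` {v})"] by (meson not_le)
  have "(\<Sum>w\<in>V. card (R `` {v})) \<le> (\<Sum>w\<in>V. card (R `` {w}))" using v by (intro sum_mono)
  then have "card V * card (R `` {v}) \<le> card R" using card_rgraph_eq_sum[OF assms(1)] by simp
  then show thesis using v that by blast
qed

lemma card_delete_vertex:
  assumes R: "rgraph V R" and v: "v \<in> V"
  shows "card R = card (R \<inter> (V - {v}) \<times> (V - {v})) + 2 * card (R `` {v})"
proof -
  let ?N = "R `` {v}" and ?R = "R \<inter> (V - {v}) \<times> (V - {v})"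
  have fin: "finite ?N" "finite ?R" using R by (auto simp: rgraph_finite_nbrs rgraph_finite_rel)
  have v': "v \<notin> ?N" using R by (auto simp: rgraph_def irrefl_def)
  have "R = ?R \<union> ({v} \<times> ?N \<union> ?N \<times> {v})"
    using R by (auto dest: rgraph_symD rgraph_inD)
  moreover have "card (?R \<union> ({v} \<times> ?N \<union> ?N \<times> {v})) = card ?R + card ({v} \<times> ?N \<union> ?N \<times> {v})"
    using fin by (intro card_Un_disjoint) auto
  moreover have "card ({v} \<times> ?N \<union> ?N \<times> {v}) = card ({v} \<times> ?N) + card (?N \<times> {v})"
    using fin v' by (intro card_Un_disjoint) auto
  ultimately show ?thesis by (simp add: card_cartesian_product)
qed

text \<open>Contracting \<open>uv\<close> destroys this edge and merges two edges at each common
  neighbour of its ends; in the degree sum each of these losses counts 2. The vertex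
  \<open>v\<close> disappears into \<open>u\<close>, so the minor lives on a subset of
  \<open>V\<close>.\<close>

lemma contraction_minor:
  assumes R: "rgraph V R" and uv: "(u, v) \<in> R"
  obtains S B where "rgraph (V - {v}) S" "model B (V - {v}) S V R"
    "card R = card S + 2 + 2 * card (R `` {u} \<inter> R `` {v})"
proof -
  define W where "W = V - {v}"
  define X where "X = R `` {v} - R `` {u} - {u}"
  define R1 where "R1 = R \<inter> W \<times> W"
  define S where "S = R1 \<union> ({u} \<times> X \<union> X \<times> {u})"
  have in_V: "u \<in> V" "v \<in> V" "u \<noteq> v" using R uv by (auto dest: rgraph_inD rgraph_neD)
  have vu: "(v, u) \<in> R" using R uv by (rule rgraph_symD)
  have fin: "finite X" "finite R1"
    unfolding X_def R1_def using R by (auto simp: rgraph_finite_nbrs rgraph_finite_rel)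
  have XW: "X \<subseteq> W" unfolding X_def W_def using R by (auto dest: rgraph_inD rgraph_neD)
  have uX: "u \<notin> X" unfolding X_def by simp
  have S: "rgraph W S"
    unfolding rgraph_def
  proof (intro conjI)
    show "finite W" using R by (simp add: rgraph_def W_def)
    show "S \<subseteq> W \<times> W" unfolding S_def R1_def using XW in_V by (auto simp: W_def)
    show "sym S" unfolding S_def R1_def sym_def using R by (auto dest: rgraph_symD)
    show "irrefl S" unfolding S_def R1_def irrefl_def using R uX by (auto dest: rgraph_neD)
  qed
  have "card S = card R1 + card ({u} \<times> X \<union> X \<times> {u})"
    unfolding S_def using fin R by (intro card_Un_disjoint) (auto simp: R1_def X_def dest: rgraph_symD)
  also have "card ({u} \<times> X \<union> X \<times> {u}) = card ({u} \<times> X) + card (X \<times> {u})"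
    using fin uX by (intro card_Un_disjoint) auto
  finally have cS: "card S = card R1 + 2 * card X" by (simp add: card_cartesian_product)
  have "R `` {v} = insert u X \<union> (R `` {u} \<inter> R `` {v})" unfolding X_def using vu by auto
  moreover have "card (insert u X \<union> (R `` {u} \<inter> R `` {v})) = card (insert u X) + card (R `` {u} \<inter> R `` {v})"
    using fin R by (intro card_Un_disjoint) (auto simp: X_def rgraph_finite_nbrs dest: rgraph_neD)
  ultimately have "card (R `` {v}) = card X + 1 + card (R `` {u} \<inter> R `` {v})"
    using fin uX by simp
  then have c: "card R = card S + 2 + 2 * card (R `` {u} \<inter> R `` {v})"
    using card_delete_vertex[OF R in_V(2)] cS unfolding R1_def W_def by simp
  define B where "B x = (if x = u then {u, v} else {x})" for x
  have "connected_in R (B x)" for x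
    unfolding B_def using uv vu by (cases "x = u") (auto intro: connected_in_star[of u] connected_in_singleton)
  moreover have "\<exists>a\<in>B x. \<exists>b\<in>B y. (a, b) \<in> R" if "(x, y) \<in> S" for x y
    using that R unfolding S_def R1_def X_def B_def by (auto dest: rgraph_symD)
  ultimately have "model B W S V R"
    unfolding model_def using in_V by (auto simp: B_def W_def split: if_splits)
  then show thesis using that S c unfolding W_def by blast
qed

text \<open>\<open>P\<close> is a free predicate on the order and the degree sum because this
  extremal choice is made twice: once for the average degree and once for the potential. Its failure
  after a contraction or deletion yields many triangles or a large degree.\<close>

lemma minimal_minor:
  fixes P :: "nat \<Rightarrow> nat \<Rightarrow> bool" and V :: "'a set"
  assumes R: "rgraph V R" and P: "P (card V) (card R)"
  obtains W :: "'a set" and S B where "rgraph W S" "model B W S V R" "P (card W) (card S)"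
    "\<And>u v. (u, v) \<in> S \<Longrightarrow> \<not> P (card W - 1) (card S - 2 - 2 * card (S `` {u} \<inter> S `` {v}))"
    "\<And>v. v \<in> W \<Longrightarrow> \<not> P (card W - 1) (card S - 2 * card (S `` {v}))"
proof -
  define M where "M n \<longleftrightarrow> (\<exists>(W :: 'a set) S B. rgraph W S \<and> model B W S V R \<and> P (card W) (card S) \<and> card W = n)" for n
  have "model (\<lambda>x. {x}) V R V R" by (rule model_singletons) auto
  then have "M (card V)" unfolding M_def using R P by blast
  then have "M (Least M)" by (rule LeastI)
  then obtain W :: "'a set" and S B where W: "rgraph W S" "model B W S V R" "P (card W) (card S)" "card W = Least M"
    unfolding M_def by blast
  have no: False if T: "rgraph U T" "model C U T W S" "P (card U) (card T)" "card U < card W"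
    for U :: "'a set" and T C
  proof -
    have "model (\<lambda>x. \<Union>w\<in>C x. B w) U T V R"
      using T(1) by (intro model_trans[OF T(2) W(2)]) (simp add: rgraph_def)
    then have "M (card U)" unfolding M_def using T by blast
    then show False using T(4) W(4) not_less_Least by metis
  qed
  have fin: "finite W" using W(1) by (simp add: rgraph_def)
  have cW: "card (W - {v}) = card W - 1" "card (W - {v}) < card W" if "v \<in> W" for v
    using card_Diff1_less[OF fin that] that by simp_all
  show thesis
  proof (rule that[OF W(1-3)])
    fix u v assume uv: "(u, v) \<in> S"
    then have v: "v \<in> W" using W(1) by (auto dest: rgraph_inD)
    obtain T C where T: "rgraph (W - {v}) T" "model C (W - {v}) T W S"
      "card S = card T + 2 + 2 * card (S `` {u} \<inter> S `` {v})"
      using contraction_minor[OF W(1) uv] .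
    then show "\<not> P (card W - 1) (card S - 2 - 2 * card (S `` {u} \<inter> S `` {v}))"
      using no[OF T(1,2)] cW[OF v] by auto
  next
    fix v assume v: "v \<in> W"
    let ?W = "W - {v}"
    let ?S = "S \<inter> ?W \<times> ?W"
    have "rgraph ?W ?S" using W(1) by (intro rgraph_restrict) auto
    moreover have "model (\<lambda>x. {x}) ?W ?S W S" by (rule model_singletons) auto
    ultimately show "\<not> P (card W - 1) (card S - 2 * card (S `` {v}))"
      using no[of ?W ?S] cW[OF v] card_delete_vertex[OF W(1) v] by auto
  qed
qed

text \<open>Deleting a vertex of minimum degree does not decrease the edge density.\<close>
lemma dense_induced_subgraph:
  assumes "rgraph V R" "m \<le> card V" "m \<ge> 1"
  obtains W where "W \<subseteq> V" "card W = m"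
    "card R * (m * (m - 1)) \<le> card (R \<inter> W \<times> W) * (card V * (card V - 1))"
proof -
  have "\<exists>W. W \<subseteq> V \<and> card W = m \<and>
    card R * (m * (m - 1)) \<le> card (R \<inter> W \<times> W) * (card V * (card V - 1))"
    using assms
  proof (induction "card V" arbitrary: V R rule: less_induct)
    case less
    have fin: "finite V" using less.prems by (simp add: rgraph_def)
    show ?case
    proof (cases "card V = m")
      case True
      have "R \<inter> V \<times> V = R" using less.prems by (auto simp: rgraph_def)
      then show ?thesis using True by (intro exI[of _ V]) auto
    next
      case False
      then have mV: "m < card V" using less.prems by simp
      then have "V \<noteq> {}" by auto
      then obtain v where v: "v \<in> V" "card V * card (R `` {v}) \<le> card R"
        using obtains_min_degree_vertex[OF less.prems(1)] by blast
      let ?V = "V - {v}"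
      let ?R = "R \<inter> ?V \<times> ?V"
      have cV: "card ?V = card V - 1" using fin v by simp
      have R': "rgraph ?V ?R" using less.prems by (intro rgraph_restrict) auto
      have "card ?V < card V" "m \<le> card ?V" using cV mV by linarith+
      then obtain W where W: "W \<subseteq> ?V" "card W = m"
        "card ?R * (m * (m - 1)) \<le> card (?R \<inter> W \<times> W) * (card ?V * (card ?V - 1))"
        using less.hyps[OF _ R' _ less.prems(3)] by blast
      have eq: "?R \<inter> W \<times> W = R \<inter> W \<times> W" using W by auto
      define n where "n = card V - 2"
      then have n: "card V = Suc (Suc n)" using mV less.prems(3) by simp
      \<comment> \<open>Deleting a vertex of minimum degree loses at most the fraction
        \<open>2 / (n + 2)\<close> of the degree sum, which is exactly the fraction of vertex pairs
        that are lost.\<close>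
      have "card R * n \<le> card ?R * (n + 2)"
      proof -
        have "card R = card ?R + 2 * card (R `` {v})" using card_delete_vertex[OF less.prems(1) v(1)] .
        moreover have "(n + 2) * card (R `` {v}) \<le> card R" using v n by simp
        ultimately show ?thesis by (simp add: algebra_simps)
      qed
      then have "card R * n * (m * (m - 1)) \<le> card ?R * (n + 2) * (m * (m - 1))" by (rule mult_right_mono) simp
      also have "\<dots> = (card ?R * (m * (m - 1))) * (n + 2)" by (simp only: ac_simps)
      also have "\<dots> \<le> (card (R \<inter> W \<times> W) * ((n + 1) * n)) * (n + 2)"
        using W(3) eq cV n by (intro mult_right_mono) auto
      finally have *: "n * (card R * (m * (m - 1))) \<le> n * (card (R \<inter> W \<times> W) * ((n + 2) * (n + 1)))"
        by (simp only: ac_simps)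
      have "card R * (m * (m - 1)) \<le> card (R \<inter> W \<times> W) * ((n + 2) * (n + 1))"
      \<comment> \<open>With two vertices the factor \<open>n\<close> cannot be cancelled, but then
        \<open>m = 1\<close> and the left-hand side vanishes.\<close>
      proof (cases "n = 0")
        case True
        then have "m = 1" using mV n less.prems(3) by simp
        then show ?thesis by simp
      next
        case False
        then show ?thesis using * by simp
      qed
      then show ?thesis using W n by (intro exI[of _ W]) auto
    qed
  qed
  then show thesis using that by blast
qed

section \<open>Embedding by a random injection\<close>

lemma graph_edge_obtain:
  assumes "graph V E" "e \<in> E"
  obtains x y where "e = {x, y}" "x \<noteq> y" "x \<in> V" "y \<in> V"
proof -
  have "card e = 2" "e \<subseteq> V" using assms by (auto simp: graph_def)
  then show thesis using that by (auto simp: card_2_iff)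
qed

lemma sum_if_const:
  "finite A \<Longrightarrow> (\<Sum>x\<in>A. if P x then c else 0) = card {x \<in> A. P x} * (c :: nat)"
  by (simp flip: sum.inter_filter)

lemma permutation_of_pair:
  assumes "a \<in> N" "b \<in> N" "c \<in> N" "d \<in> N" "a \<noteq> b" "c \<noteq> d"
  obtains \<sigma> where "\<sigma> permutes N" "\<sigma> a = c" "\<sigma> b = d"
proof -
  define e where "e = transpose a c b"
  have e: "e \<in> N" "e \<noteq> c" using assms by (auto simp: e_def transpose_def)
  have "transpose e d \<circ> transpose a c permutes N"
    using assms e by (intro permutes_compose permutes_swap_id) auto
  moreover have "(transpose e d \<circ> transpose a c) a = c" using e assms by (simp add: transpose_def)
  moreover have "(transpose e d \<circ> transpose a c) b = d" by (simp flip: e_def)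
  ultimately show thesis using that by blast
qed

text \<open>A random permutation sends \<open>(a, b)\<close> to a uniformly distributed ordered pair
  of distinct vertices, which is non-adjacent with probability at most
  \<open>(n - 1 - \<tau>) / (n - 1)\<close> for \<open>n = card N\<close>. Multiplied out, this is a
  count of permutations in the naturals.\<close>

lemma card_permutations_pair_not_in:
  assumes T: "rgraph N T" and N: "a \<in> N" "b \<in> N" "a \<noteq> b"
    and deg: "\<And>v. v \<in> N \<Longrightarrow> \<tau> \<le> card (T `` {v})"
  shows "card {\<pi>. \<pi> permutes N \<and> (\<pi> a, \<pi> b) \<notin> T} * (card N - 1) \<le> fact (card N) * (card N - 1 - \<tau>)"
proof -
  define c where "c p = card {\<pi>. \<pi> permutes N \<and> (\<pi> (fst p), \<pi> (snd p)) \<notin> T}" for p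
  define D where "D = {p \<in> N \<times> N. fst p \<noteq> snd p}"
  define n where "n = card N"
  have finN: "finite N" using T by (simp add: rgraph_def)
  have finD: "finite D" unfolding D_def using finN by simp
  have finP: "finite {\<pi>. \<pi> permutes N}" using finN by (rule finite_permutations)
  have n: "n > 0" unfolding n_def using N(1) finN by (auto simp: card_gt_0_iff)
  have D_Sigma: "D = Sigma N (\<lambda>x. N - {x})" unfolding D_def by auto
  have cD: "card D = n * (n - 1)" unfolding D_Sigma n_def using finN by (simp add: card_SigmaI)
  have DT: "D - T = Sigma N (\<lambda>x. N - {x} - T `` {x})" unfolding D_Sigma by auto
  have "card (D - T) = (\<Sum>x\<in>N. card (N - {x} - T `` {x}))"
    unfolding DT using finN by (intro card_SigmaI) auto
  also have "\<dots> \<le> (\<Sum>x\<in>N. n - 1 - \<tau>)"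
  proof (rule sum_mono)
    fix x assume x: "x \<in> N"
    have "T `` {x} \<subseteq> N - {x}" using T by (auto dest: rgraph_inD rgraph_neD)
    then have "card (N - {x} - T `` {x}) = n - 1 - card (T `` {x})"
      using finN x n_def by (simp add: card_Diff_subset finite_subset[of _ "N - {x}"])
    then show "card (N - {x} - T `` {x}) \<le> n - 1 - \<tau>" using deg[OF x] by simp
  qed
  finally have cDT: "card (D - T) \<le> n * (n - 1 - \<tau>)" by (simp add: n_def)
  \<comment> \<open>Precomposition with a permutation taking \<open>p\<close> to
    \<open>(a, b)\<close> shows that all pairs have the same count, which can therefore be found by
    summing over \<open>D\<close>.\<close>
  have c_eq: "c p = c (a, b)" if p: "p \<in> D" for p
  proof -
    have "fst p \<in> N" "snd p \<in> N" "fst p \<noteq> snd p" using p by (auto simp: D_def)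
    then obtain \<sigma> where \<sigma>: "\<sigma> permutes N" "\<sigma> (fst p) = a" "\<sigma> (snd p) = b"
      using permutation_of_pair N by metis
    have "bij_betw (\<lambda>\<pi>. \<pi> \<circ> \<sigma>) {\<pi>. \<pi> permutes N \<and> (\<pi> a, \<pi> b) \<notin> T}
       {\<pi>. \<pi> permutes N \<and> (\<pi> (fst p), \<pi> (snd p)) \<notin> T}"
    proof (rule bij_betw_byWitness[where f' = "\<lambda>\<pi>. \<pi> \<circ> inv \<sigma>"])
      show "\<forall>\<pi>\<in>{\<pi>. \<pi> permutes N \<and> (\<pi> a, \<pi> b) \<notin> T}. (\<pi> \<circ> \<sigma>) \<circ> inv \<sigma> = \<pi>"
        using permutes_inv_o(1)[OF \<sigma>(1)] by (simp add: comp_assoc)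
      show "\<forall>\<pi>\<in>{\<pi>. \<pi> permutes N \<and> (\<pi> (fst p), \<pi> (snd p)) \<notin> T}. (\<pi> \<circ> inv \<sigma>) \<circ> \<sigma> = \<pi>"
        using permutes_inv_o(2)[OF \<sigma>(1)] by (simp add: comp_assoc)
      show "(\<lambda>\<pi>. \<pi> \<circ> \<sigma>) ` {\<pi>. \<pi> permutes N \<and> (\<pi> a, \<pi> b) \<notin> T}
         \<subseteq> {\<pi>. \<pi> permutes N \<and> (\<pi> (fst p), \<pi> (snd p)) \<notin> T}"
        using \<sigma> by (auto intro: permutes_compose)
      have "inv \<sigma> a = fst p" "inv \<sigma> b = snd p" using \<sigma> by (auto simp: permutes_inv_eq)
      then show "(\<lambda>\<pi>. \<pi> \<circ> inv \<sigma>) ` {\<pi>. \<pi> permutes N \<and> (\<pi> (fst p), \<pi> (snd p)) \<notin> T}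
         \<subseteq> {\<pi>. \<pi> permutes N \<and> (\<pi> a, \<pi> b) \<notin> T}"
        using permutes_compose[OF permutes_inv[OF \<sigma>(1)]] by auto
    qed
    then show ?thesis unfolding c_def by (simp add: bij_betw_same_card)
  qed
  have "c (a, b) * (n * (n - 1)) = (\<Sum>p\<in>D. c p)" using c_eq cD by simp
  also have "\<dots> = (\<Sum>p\<in>D. \<Sum>\<pi> | \<pi> permutes N. if (\<pi> (fst p), \<pi> (snd p)) \<notin> T then 1 else 0)"
    unfolding c_def
  proof (rule sum.cong[OF HOL.refl])
    fix p :: "'a \<times> 'a"
    show "card {\<pi>. \<pi> permutes N \<and> (\<pi> (fst p), \<pi> (snd p)) \<notin> T} =
      (\<Sum>\<pi> | \<pi> permutes N. if (\<pi> (fst p), \<pi> (snd p)) \<notin> T then 1 else 0)"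
      using sum_if_const[OF finP, of "\<lambda>\<pi>. (\<pi> (fst p), \<pi> (snd p)) \<notin> T" 1] by simp
  qed
  also have "\<dots> = (\<Sum>\<pi> | \<pi> permutes N. \<Sum>p\<in>D. if (\<pi> (fst p), \<pi> (snd p)) \<notin> T then 1 else 0)"
    by (rule sum.swap)
  \<comment> \<open>Each \<open>\<pi>\<close> permutes the pairs in \<open>D\<close>, so exactly
    \<open>card (D - T)\<close> of them land outside \<open>T\<close>.\<close>
  also have "\<dots> = (\<Sum>\<pi> | \<pi> permutes N. card (D - T))"
  proof (rule sum.cong[OF HOL.refl])
    fix \<pi> assume "\<pi> \<in> {\<pi>. \<pi> permutes N}"
    then have \<pi>: "\<pi> permutes N" by simp
    have "bij_betw (\<lambda>p. (\<pi> (fst p), \<pi> (snd p))) {p \<in> D. (\<pi> (fst p), \<pi> (snd p)) \<notin> T} (D - T)"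
    proof (rule bij_betw_byWitness[where f' = "\<lambda>p. (inv \<pi> (fst p), inv \<pi> (snd p))"])
      show "(\<lambda>p. (\<pi> (fst p), \<pi> (snd p))) ` {p \<in> D. (\<pi> (fst p), \<pi> (snd p)) \<notin> T} \<subseteq> D - T"
        unfolding D_def using permutes_in_image[OF \<pi>] permutes_inj[OF \<pi>] by (auto dest: injD)
      show "(\<lambda>p. (inv \<pi> (fst p), inv \<pi> (snd p))) ` (D - T) \<subseteq> {p \<in> D. (\<pi> (fst p), \<pi> (snd p)) \<notin> T}"
        unfolding D_def using permutes_in_image[OF permutes_inv[OF \<pi>]]
          permutes_inj[OF permutes_inv[OF \<pi>]] permutes_inverses[OF \<pi>] by (auto dest: injD)
    qed (auto simp: permutes_inverses[OF \<pi>])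
    then show "(\<Sum>p\<in>D. if (\<pi> (fst p), \<pi> (snd p)) \<notin> T then 1 else 0) = card (D - T)"
      by (subst sum_if_const[OF finD]) (simp add: bij_betw_same_card)
  qed
  also have "\<dots> = fact n * card (D - T)" using card_permutations[OF n_def[symmetric] finN] by simp
  also have "\<dots> \<le> fact n * (n * (n - 1 - \<tau>))" using cDT by simp
  finally have "n * (c (a, b) * (n - 1)) \<le> n * (fact n * (n - 1 - \<tau>))" by (simp add: ac_simps)
  then have "c (a, b) * (n - 1) \<le> fact n * (n - 1 - \<tau>)" using n by simp
  then show ?thesis unfolding c_def n_def by simp
qed

text \<open>A fixed injection followed by a uniformly random permutation is a random injection.
  Linearity of expectation bounds the mean number of edges sent to non-adjacent pairs, and some
  permutation does no worse than the mean.\<close>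

lemma injection_few_nonadjacent:
  assumes T: "rgraph N T" and H: "graph U E" "finite E" and card_le: "card U \<le> card N"
    and deg: "\<And>v. v \<in> N \<Longrightarrow> \<tau> \<le> card (T `` {v})"
  obtains \<phi> where "inj_on \<phi> U" "\<phi> ` U \<subseteq> N"
    "card {e \<in> E. \<exists>x y. e = {x, y} \<and> (\<phi> x, \<phi> y) \<notin> T} * (card N - 1) \<le> card E * (card N - 1 - \<tau>)"
proof -
  define n where "n = card N"
  have finN: "finite N" using T by (simp add: rgraph_def)
  have finU: "finite U" using H by (simp add: graph_def)
  let ?P = "{\<pi>. \<pi> permutes N}"
  have finP: "finite ?P" using finN by (rule finite_permutations)
  obtain f where f: "inj_on f U" "f ` U \<subseteq> N"
    using card_le_inj[OF finU finN card_le] by auto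
  define bad where "bad \<pi> e \<longleftrightarrow> (\<exists>x y. e = {x, y} \<and> (\<pi> (f x), \<pi> (f y)) \<notin> T)" for \<pi> e
  have edge_le: "card {\<pi> \<in> ?P. bad \<pi> e} * (n - 1) \<le> fact n * (n - 1 - \<tau>)" if e: "e \<in> E" for e
  proof -
    obtain x y where xy: "e = {x, y}" "x \<noteq> y" "x \<in> U" "y \<in> U"
      using graph_edge_obtain[OF H(1) e] .
    have "bad \<pi> e \<longleftrightarrow> (\<pi> (f x), \<pi> (f y)) \<notin> T" for \<pi>
      unfolding bad_def xy(1) using rgraph_symD[OF T] by (auto simp: doubleton_eq_iff)
    moreover have "f x \<in> N" "f y \<in> N" "f x \<noteq> f y" using f xy by (auto dest: inj_onD)
    ultimately show ?thesis
      using card_permutations_pair_not_in[OF T, of "f x" "f y" \<tau>] deg unfolding n_def by simp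
  qed
  have "\<exists>\<pi>\<in>?P. card {e \<in> E. bad \<pi> e} * (n - 1) \<le> card E * (n - 1 - \<tau>)"
  proof (rule ccontr)
    assume "\<not> ?thesis"
    then have gt: "card E * (n - 1 - \<tau>) < card {e \<in> E. bad \<pi> e} * (n - 1)" if "\<pi> \<in> ?P" for \<pi>
      using that by (meson not_le)
    have ne: "?P \<noteq> {}" using permutes_id by blast
    have "fact n * (card E * (n - 1 - \<tau>)) = (\<Sum>\<pi>\<in>?P. card E * (n - 1 - \<tau>))"
      using card_permutations[OF n_def[symmetric] finN] by simp
    also have "\<dots> < (\<Sum>\<pi>\<in>?P. card {e \<in> E. bad \<pi> e} * (n - 1))"
      using gt finP ne by (intro sum_strict_mono) auto
    also have "\<dots> = (\<Sum>\<pi>\<in>?P. \<Sum>e\<in>E. if bad \<pi> e then n - 1 else 0)"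
      by (intro sum.cong HOL.refl sum_if_const[OF H(2), symmetric])
    also have "\<dots> = (\<Sum>e\<in>E. \<Sum>\<pi>\<in>?P. if bad \<pi> e then n - 1 else 0)" by (rule sum.swap)
    also have "\<dots> = (\<Sum>e\<in>E. card {\<pi> \<in> ?P. bad \<pi> e} * (n - 1))"
      by (intro sum.cong HOL.refl sum_if_const[OF finP])
    also have "\<dots> \<le> (\<Sum>e\<in>E. fact n * (n - 1 - \<tau>))" using edge_le by (rule sum_mono)
    finally show False by (simp add: ac_simps)
  qed
  then obtain \<pi> where \<pi>: "\<pi> permutes N" "card {e \<in> E. bad \<pi> e} * (n - 1) \<le> card E * (n - 1 - \<tau>)"
    by blast
  show thesis
  proof (rule that)
    show "inj_on (\<pi> \<circ> f) U" using f permutes_inj_on[OF \<pi>(1)] by (intro comp_inj_on) auto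
    show "(\<pi> \<circ> f) ` U \<subseteq> N" using f permutes_in_image[OF \<pi>(1)] by auto
    show "card {e \<in> E. \<exists>x y. e = {x, y} \<and> ((\<pi> \<circ> f) x, (\<pi> \<circ> f) y) \<notin> T} * (card N - 1)
        \<le> card E * (card N - 1 - \<tau>)"
      using \<pi>(2) unfolding bad_def n_def by simp
  qed
qed

text \<open>When every set is at least as large as the whole index set, a greedy choice never gets
  stuck.\<close>

lemma distinct_representatives:
  assumes "finite X" "\<And>x. x \<in> X \<Longrightarrow> finite (S x) \<and> card X \<le> card (S x)"
  shows "\<exists>f. inj_on f X \<and> (\<forall>x\<in>X. f x \<in> S x)"
  using assms
proof (induction X rule: finite_induct)
  case (insert x X)
  have "\<And>y. y \<in> X \<Longrightarrow> finite (S y) \<and> card X \<le> card (S y)"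
    using insert.prems insert.hyps by fastforce
  then obtain f where f: "inj_on f X" "\<forall>y\<in>X. f y \<in> S y" using insert.IH by blast
  have "card (f ` X) \<le> card X" using insert.hyps by (simp add: card_image_le)
  then have "card (f ` X) < card (S x)" using insert.prems[of x] insert.hyps by simp
  then have "\<not> S x \<subseteq> f ` X" using insert.hyps by (meson card_mono finite_imageI not_le)
  then obtain s where s: "s \<in> S x" "s \<notin> f ` X" by blast
  have "inj_on (f(x := s)) (insert x X)" using f s insert.hyps by (auto simp: inj_on_def)
  moreover have "\<forall>y\<in>insert x X. (f(x := s)) y \<in> S y" using f s insert.hyps by auto
  ultimately show ?case by blast
qed auto

text \<open>An edge of the guest whose ends are not mapped to adjacent vertices is subdivided once by
  a common neighbour of its ends; the new vertex joins the branch set of one end.\<close>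
lemma model_from_injection:
  assumes T: "rgraph N T" and H: "graph U E" "finite E"
    and \<phi>: "inj_on \<phi> U" "\<phi> ` U \<subseteq> N"
    and common: "\<And>a b. a \<in> N \<Longrightarrow> b \<in> N \<Longrightarrow> a \<noteq> b \<Longrightarrow> (a, b) \<notin> T \<Longrightarrow>
      card U + card {e \<in> E. \<exists>x y. e = {x, y} \<and> (\<phi> x, \<phi> y) \<notin> T} \<le> card (T `` {a} \<inter> T `` {b}) + 2"
  obtains B where "model B U (edge_rel E) N T"
proof -
  define X where "X = {e \<in> E. \<exists>x y. e = {x, y} \<and> (\<phi> x, \<phi> y) \<notin> T}"
  have finU: "finite U" using H by (simp add: graph_def)
  have finN: "finite N" using T by (simp add: rgraph_def)
  have finX: "finite X" using H by (simp add: X_def)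
  define S where "S e = {c \<in> N - \<phi> ` U. \<forall>x\<in>e. (\<phi> x, c) \<in> T}" for e
  have "finite (S e) \<and> card X \<le> card (S e)" if e: "e \<in> X" for e
  proof -
    obtain x y where xy: "e = {x, y}" "(\<phi> x, \<phi> y) \<notin> T" and eE: "e \<in> E" using e by (auto simp: X_def)
    then have xy': "x \<in> U" "y \<in> U" "x \<noteq> y" using H(1) unfolding graph_def by force+
    then have ne: "\<phi> x \<noteq> \<phi> y" using \<phi> by (auto dest: inj_onD)
    let ?C = "T `` {\<phi> x} \<inter> T `` {\<phi> y}"
    \<comment> \<open>The images \<open>\<phi> x\<close> and \<open>\<phi> y\<close> are not among
      their own common neighbours, so only the other \<open>card U - 2\<close> occupied vertices
      must be avoided; hence the \<open>+ 2\<close> in \<open>common\<close>.\<close>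
    have C: "?C \<subseteq> N" "\<phi> x \<notin> ?C" "\<phi> y \<notin> ?C" using T by (auto dest: rgraph_inD rgraph_neD)
    have "?C - (\<phi> ` U - {\<phi> x, \<phi> y}) = S e" unfolding S_def xy(1) using C by auto
    moreover have "card ?C - card (\<phi> ` U - {\<phi> x, \<phi> y}) \<le> card (?C - (\<phi> ` U - {\<phi> x, \<phi> y}))"
      using finU by (intro diff_card_le_card_Diff) auto
    moreover have "card (\<phi> ` U - {\<phi> x, \<phi> y}) = card U - 2"
      using xy' ne finU \<phi> by (subst card_Diff_subset) (auto simp: card_image)
    moreover have "card U + card X \<le> card ?C + 2"
      unfolding X_def using common[of "\<phi> x" "\<phi> y"] xy xy' ne \<phi> by auto
    moreover have "card U \<ge> 2" using xy' finU card_mono[of U "{x, y}"] by auto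
    ultimately have "card X \<le> card (S e)" by simp
    then show ?thesis using finN by (simp add: S_def)
  qed
  then obtain s where s: "inj_on s X" "\<forall>e\<in>X. s e \<in> S e"
    using distinct_representatives[OF finX, of S] by blast
  define own where "own e = (SOME x. x \<in> e)" for e :: "'b set"
  have own: "own e \<in> e" if "e \<in> E" for e
  proof -
    have "e \<noteq> {}" using H(1) that by (auto simp: graph_def)
    then show ?thesis unfolding own_def by (simp add: some_in_eq)
  qed
  define B where "B x = insert (\<phi> x) (s ` {e \<in> X. own e = x})" for x
  have XE: "X \<subseteq> E" by (auto simp: X_def)
  have sT: "(\<phi> x, s e) \<in> T" "s e \<in> N" "s e \<notin> \<phi> ` U" if "e \<in> X" "x \<in> e" for e x
    using s(2) that unfolding S_def by auto
  have ownX: "own e \<in> e" if "e \<in> X" for e using own that XE by blast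
  have "B x \<subseteq> N" if "x \<in> U" for x
    using that \<phi>(2) sT(2) ownX unfolding B_def by blast
  moreover have "connected_in T (B x)" for x
  proof (rule connected_in_star[of "\<phi> x"])
    show "\<phi> x \<in> B x" by (simp add: B_def)
    fix a assume "a \<in> B x" "a \<noteq> \<phi> x"
    then obtain e where "e \<in> X" "own e = x" "a = s e" unfolding B_def by blast
    then have "(\<phi> x, a) \<in> T" using sT(1)[of e x] ownX by blast
    then show "(a, \<phi> x) \<in> T \<and> (\<phi> x, a) \<in> T" using rgraph_symD[OF T] by blast
  qed
  moreover have "B x \<inter> B y = {}" if xy: "x \<in> U" "y \<in> U" "x \<noteq> y" for x y
  proof -
    have "\<phi> x \<noteq> \<phi> y" using \<phi> xy by (auto dest: inj_onD)
    moreover have "\<phi> z \<notin> s ` X" if "z \<in> U" for z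
    proof
      assume "\<phi> z \<in> s ` X"
      then obtain e where "e \<in> X" "\<phi> z = s e" by blast
      then show False using sT(3)[OF _ ownX] that by (metis imageI)
    qed
    moreover have "s ` {e \<in> X. own e = x} \<inter> s ` {e \<in> X. own e = y} = {}"
      using s(1) xy(3) by (auto dest: inj_onD)
    ultimately show ?thesis unfolding B_def using xy by auto
  qed
  moreover have "\<exists>a\<in>B x. \<exists>b\<in>B y. (a, b) \<in> T" if "(x, y) \<in> edge_rel E" for x y
  proof (cases "{x, y} \<in> X")
    case True
    then consider "own {x, y} = x" | "own {x, y} = y" using ownX by blast
    then show ?thesis
    proof cases
      case 1
      then have "s {x, y} \<in> B x" using True by (auto simp: B_def)
      moreover have "(s {x, y}, \<phi> y) \<in> T" using sT(1)[OF True, of y] rgraph_symD[OF T] by blast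
      ultimately show ?thesis by (auto simp: B_def)
    next
      case 2
      then have "s {x, y} \<in> B y" using True by (auto simp: B_def)
      moreover have "(\<phi> x, s {x, y}) \<in> T" using sT(1)[OF True, of x] by blast
      ultimately show ?thesis by (auto simp: B_def)
    qed
  next
    case False
    then have "(\<phi> x, \<phi> y) \<in> T" using that unfolding X_def edge_rel_def by blast
    then show ?thesis by (auto simp: B_def)
  qed
  ultimately have "model B U (edge_rel E) N T" unfolding model_def by blast
  then show thesis using that by blast
qed

section \<open>A potential for the average degree\<close>

text \<open>Here \<open>d = 2 * (1 + t) - y\<close> for an edge in \<open>t\<close> triangles. The
  logarithms are linearised by \<open>ln x \<le> x - 1\<close>: the order term gains at least
  \<open>3 / 2 * (1 / h)\<close>, and the degree terms lose at most
  \<open>\<epsilon> / q + \<epsilon> / (2 * (y - 1))\<close>.\<close>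

lemma contraction_loss_bound:
  fixes q y h d :: real
  assumes q: "q \<ge> 2" "y > q" "h \<ge> q + 1" "d \<le> h - 1"
    and less: "(y - d / (h - 1)) / q + ln (y - d / (h - 1)) / 2 - 3 / 2 * ln (h - 1)
      < y / q + ln y / 2 - 3 / 2 * ln h"
  shows "3 / 2 * q\<^sup>2 / (q + 1) < d * (1 + q / (2 * (y - 1)))"
proof -
  define \<epsilon> where "\<epsilon> = d / (h - 1)"
  have pos: "q > 0" "y > 1" "h > 1" "h - 1 > 0" using q by auto
  have \<epsilon>1: "\<epsilon> \<le> 1" unfolding \<epsilon>_def using q pos by (simp add: divide_le_eq)
  have "ln ((h - 1) / h) \<le> (h - 1) / h - 1" using pos by (intro ln_le_minus_one) auto
  then have lnh: "ln h - ln (h - 1) \<ge> 1 / h" using pos by (simp add: ln_div field_simps)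
  have L: "3 / 2 * (1 / h) < \<epsilon> / q + (ln y - ln (y - \<epsilon>)) / 2"
    using less lnh unfolding \<epsilon>_def[symmetric] diff_divide_distrib[of y] by argo
  have \<epsilon>0: "\<epsilon> > 0"
  proof (rule ccontr)
    assume "\<not> \<epsilon> > 0"
    then have "ln y \<le> ln (y - \<epsilon>)" "\<epsilon> / q \<le> 0" using pos by (auto simp: divide_le_0_iff)
    moreover have "1 / h > 0" using pos by simp
    ultimately show False using L by argo
  qed
  have "ln (y / (y - \<epsilon>)) \<le> y / (y - \<epsilon>) - 1" using pos \<epsilon>1 by (intro ln_le_minus_one) auto
  also have "\<dots> = \<epsilon> / (y - \<epsilon>)" using pos \<epsilon>1 by (simp add: field_simps)
  also have "\<dots> \<le> \<epsilon> / (y - 1)" using pos \<epsilon>0 \<epsilon>1 by (intro divide_left_mono) auto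
  finally have "ln y - ln (y - \<epsilon>) \<le> \<epsilon> / (y - 1)" using pos \<epsilon>1 by (simp add: ln_div)
  then have "(ln y - ln (y - \<epsilon>)) / 2 \<le> \<epsilon> / (y - 1) / 2" by (rule divide_right_mono) simp
  then have "3 / 2 * (1 / h) < \<epsilon> / q + \<epsilon> / (y - 1) / 2"
    by (rule less_le_trans[OF L add_left_mono])
  also have "\<dots> = \<epsilon> * (1 + q / (2 * (y - 1))) / q" using pos by (simp add: field_simps)
  finally have "3 / 2 * (1 / h) * (q * (h - 1)) < \<epsilon> * (1 + q / (2 * (y - 1))) / q * (q * (h - 1))"
    using pos by (intro mult_strict_right_mono) auto
  also have "\<dots> = d * (1 + q / (2 * (y - 1)))" unfolding \<epsilon>_def using pos by simp
  finally have "3 / 2 * q * ((h - 1) / h) < d * (1 + q / (2 * (y - 1)))" by simp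
  moreover have "q / (q + 1) \<le> (h - 1) / h" using q pos by (simp add: field_simps)
  then have "3 / 2 * q * (q / (q + 1)) \<le> 3 / 2 * q * ((h - 1) / h)"
    using pos by (intro mult_left_mono) auto
  moreover have "3 / 2 * q * (q / (q + 1)) = 3 / 2 * q\<^sup>2 / (q + 1)" by (simp add: power2_eq_square)
  ultimately show ?thesis by linarith
qed

text \<open>For a vertex of degree \<open>n\<close> whose neighbourhood has minimum degree
  \<open>\<tau>\<close>. Divided by \<open>n - 1\<close>, the last conclusion compares the expected
  number of edges to be subdivided with the free common neighbours: non-adjacent vertices share at
  least \<open>2 * \<tau> - (n - 2)\<close>, of which at most \<open>q - 2\<close> are
  occupied.\<close>

lemma neighbourhood_density_bound:
  fixes q y n \<tau> :: real
  assumes q: "q \<ge> 2" "y > q" "n \<le> y" "\<tau> \<le> n - 1"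
    and loss: "3 / 2 * q\<^sup>2 / (q + 1) < (2 * (1 + \<tau>) - y) * (1 + q / (2 * (y - 1)))"
  shows "n > q - 1" "n > 1" "q * (n - 1 - \<tau>) \<le> (n - 1) * (2 * \<tau> - n + 4 - q)"
proof -
  define d where "d = 2 * (1 + \<tau>) - y"
  define p where "p = q / (2 * (y - 1))"
  define d' where "d' = 2 * (1 + \<tau>) - n"
  have p0: "p > 0" unfolding p_def using q by auto
  have p: "p \<le> q / (2 * (q - 1))" unfolding p_def using q by (intro divide_left_mono) auto
  have p': "q / (2 * (q - 1)) = 1 / 2 + 1 / 2 * (1 / (q - 1))" using q by (simp add: field_simps)
  have s: "3 / 2 * q\<^sup>2 / (q + 1) = 3 / 2 * (q - 1) + 3 / 2 * (1 / (q + 1))"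
    using q by (simp add: field_simps power2_eq_square)
  have "1 / (q - 1) \<le> 3 * (1 / (q + 1))" using q by (simp add: field_simps)
  \<comment> \<open>The target is linear in \<open>d' - 1\<close>, so one unit is taken off
    \<open>d\<close> at the cost \<open>1 + p\<close>. Here \<open>p\<close> is at most
    \<open>1 / 2 + 3 / 2 * (1 / (q + 1))\<close>, whose second summand cancels the one in
    \<open>s\<close>.\<close>
  then have A: "3 / 2 * q - 3 < (d - 1) * (1 + p)"
  proof -
    have "(d - 1) * (1 + p) = d * (1 + p) - 1 - p" by (simp add: algebra_simps)
    moreover have "3 / 2 * (q - 1) + 3 / 2 * (1 / (q + 1)) < d * (1 + p)"
      using loss s unfolding d_def p_def by simp
    ultimately show ?thesis using p p' \<open>1 / (q - 1) \<le> 3 * (1 / (q + 1))\<close> by argo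
  qed
  have d1: "d > 1"
  proof (rule ccontr)
    assume "\<not> d > 1"
    then have "(d - 1) * (1 + p) \<le> 0" using p0 by (intro mult_nonpos_nonneg) auto
    then show False using A q by linarith
  qed
  have dd: "d \<le> d'" "d' \<le> n" unfolding d_def d'_def using q by auto
  then show n1: "n > 1" using d1 by linarith
  have "d > q - 2"
  proof (rule ccontr)
    assume "\<not> d > q - 2"
    then have "(d - 1) * (1 + p) \<le> (q - 3) * (1 + p)" using p0 by (intro mult_right_mono) auto
    moreover have "q - 3 > 0" using \<open>\<not> d > q - 2\<close> d1 by linarith
    then have "(q - 3) * (1 + p) \<le> (q - 3) * (3 / 2 + 1 / 2 * (1 / (q - 1)))"
      using p p' by (intro mult_left_mono) auto
    moreover have "(q - 3) * (1 / (q - 1)) \<le> 1" using q by (simp add: field_simps)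
    moreover have "(q - 3) * (3 / 2 + 1 / 2 * (1 / (q - 1))) = 3 / 2 * (q - 3) + 1 / 2 * ((q - 3) * (1 / (q - 1)))"
      by (simp only: distrib_left mult.left_commute mult.commute)
    ultimately show False using A by argo
  qed
  then show "n > q - 1" using q(2-4) d_def by argo
  \<comment> \<open>Replacing \<open>y\<close> by the smaller \<open>n\<close> only enlarges the
    right-hand side of \<open>A\<close>.\<close>
  have "p \<le> q / (2 * (n - 1))" unfolding p_def using q n1 by (intro divide_left_mono) auto
  then have "(d - 1) * (1 + p) \<le> (d' - 1) * (1 + q / (2 * (n - 1)))"
    using d1 dd p0 by (intro mult_mono) auto
  then have "(3 / 2 * q - 3) * (2 * (n - 1)) \<le> (d' - 1) * (1 + q / (2 * (n - 1))) * (2 * (n - 1))"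
    using A n1 by (intro mult_right_mono) auto
  also have "\<dots> = (d' - 1) * (2 * (n - 1) + q)" using n1 by (simp add: field_simps)
  finally have "(3 / 2 * q - 3) * (2 * (n - 1)) \<le> (d' - 1) * (2 * (n - 1) + q)" .
  \<comment> \<open>Cleared of denominators, \<open>A\<close> with \<open>n\<close> for
    \<open>y\<close> is twice the target.\<close>
  moreover have "2 * ((n - 1) * (2 * \<tau> - n + 4 - q)) - 2 * (q * (n - 1 - \<tau>))
      = (d' - 1) * (2 * (n - 1) + q) - (3 / 2 * q - 3) * (2 * (n - 1))"
    unfolding d'_def by (simp add: field_simps)
  moreover have "Q \<le> P" if "M \<le> K" "2 * P - 2 * Q = K - M" for M K P Q :: real using that by linarith
  ultimately show "q * (n - 1 - \<tau>) \<le> (n - 1) * (2 * \<tau> - n + 4 - q)" by blast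
qed

text \<open>Contracting an edge in \<open>t\<close> triangles replaces the average degree \<open>y = r / h\<close> by
  \<open>y - (2 * (1 + t) - y) / (h - 1)\<close>. In a minor with fewest vertices among those that do not decrease
  the potential \<open>y / q + ln y / 2 - 3 / 2 * ln h\<close>, every edge therefore lies in so many triangles that
  a random injection into the neighbourhood of a vertex of minimum degree can be completed to a model.\<close>
lemma model_of_large_potential:
  fixes V :: "'a set" and U :: "'b set"
  assumes R: "rgraph V R" and H: "graph U E" "finite E" and U: "card U \<le> card E"
    and q2: "2 \<le> card E" and qV: "card E \<le> card V" and R0: "R \<noteq> {}"
    and pot: "1 - ln (card E) < card R / card V / card E + ln (card R / card V) / 2 - 3 / 2 * ln (card V)"
  obtains B where "model B U (edge_rel E) V R"
proof -
  define q where "q = real (card E)"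
  define \<Phi> where "\<Phi> h r = real r / real h / q + ln (real r / real h) / 2 - 3 / 2 * ln (real h)" for h r :: nat
  \<comment> \<open>\<open>card E \<le> h\<close> is the stopping rule; \<open>0 < r\<close> keeps
    the average degree away from the default value of \<open>ln\<close> at 0.\<close>
  define P where "P h r \<longleftrightarrow> card E \<le> h \<and> 0 < r \<and> 1 - ln q < \<Phi> h r \<and> \<Phi> (card V) (card R) \<le> \<Phi> h r" for h r
  have q: "q \<ge> 2" using q2 by (simp add: q_def)
  have "P (card V) (card R)"
    unfolding P_def \<Phi>_def q_def using qV R0 rgraph_finite_rel[OF R] pot by (auto simp: card_gt_0_iff)
  then obtain W :: "'a set" and S B0 where S: "rgraph W S" and B0: "model B0 W S V R" and PW: "P (card W) (card S)"
    and edges: "\<And>u v. (u, v) \<in> S \<Longrightarrow> \<not> P (card W - 1) (card S - 2 - 2 * card (S `` {u} \<inter> S `` {v}))"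
    and verts: "\<And>v. v \<in> W \<Longrightarrow> \<not> P (card W - 1) (card S - 2 * card (S `` {v}))"
    using minimal_minor[OF R, of P] by metis
  define h where "h = real (card W)"
  define r where "r = real (card S)"
  define y where "y = r / h"
  have finW: "finite W" using S by (simp add: rgraph_def)
  have h: "h \<ge> q" "h > 0" using PW q unfolding P_def h_def q_def by auto
  have r0: "r > 0" using PW unfolding P_def r_def by auto
  have y0: "y > 0" unfolding y_def using h r0 by simp
  have rel: "real (card S) \<le> real (card W * (card W - 1))" using card_rgraph_le[OF S] of_nat_le_iff by blast
  have W1: "1 \<le> card W" using h h_def by simp
  have yh: "y \<le> h - 1"
    using rel W1 h(2) unfolding y_def r_def h_def by (simp add: divide_le_eq of_nat_diff mult.commute)
  have pw: "1 - ln q < y / q + ln y / 2 - 3 / 2 * ln h"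
    using PW unfolding P_def \<Phi>_def y_def r_def h_def by blast
  \<comment> \<open>Otherwise \<open>y \<le> q \<le> h\<close> bounds the potential by
    \<open>1 + ln q / 2 - 3 / 2 * ln q\<close>, which is the threshold
    \<open>1 - ln q\<close>.\<close>
  have yq: "y > q"
  proof (rule ccontr)
    assume "\<not> y > q"
    then have "y / q \<le> 1" "ln y \<le> ln q" using q y0 by auto
    moreover have "ln q \<le> ln h" using h q by auto
    ultimately show False using pw by linarith
  qed
  then have hq: "h > q + 1" using yh by linarith
  have cW: "real (card W - 1) = h - 1" using W1 by (simp add: h_def of_nat_diff)
  have qW: "card E \<le> card W - 1"
  proof -
    have "real (card E) \<le> real (card W - 1)" using hq cW q_def by simp
    then show ?thesis using of_nat_le_iff by blast
  qed
  \<comment> \<open>As \<open>card W - 1\<close> still satisfies the size clause, \<open>P\<close>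
    can only fail through a drop of the potential.\<close>
  have no: "\<Phi> (card W - 1) r' < \<Phi> (card W) (card S)" if "\<not> P (card W - 1) r'" "0 < r'" for r'
    using that qW PW unfolding P_def by linarith
  have "W \<noteq> {}" using W1 by auto
  then obtain v where v: "v \<in> W" "card W * card (S `` {v}) \<le> card S"
    using obtains_min_degree_vertex[OF S] by blast
  define N where "N = S `` {v}"
  define n where "n = real (card N)"
  have "h * n \<le> r" using v(2) unfolding h_def n_def r_def N_def by (metis of_nat_le_iff of_nat_mult)
  then have ny: "n \<le> y" unfolding y_def using h by (simp add: le_divide_eq mult.commute)
  have finN: "finite N" unfolding N_def using S by (rule rgraph_finite_nbrs)
  \<comment> \<open>Deleting an isolated vertex would raise the average degree and lower the order,
    so the potential would not drop.\<close>
  have Nne: "N \<noteq> {}"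
  proof
    assume "N = {}"
    then have "\<Phi> (card W - 1) (card S) < \<Phi> (card W) (card S)"
      using no[of "card S"] verts[OF v(1)] r0 by (simp add: N_def r_def)
    then have "r / (h - 1) / q + ln (r / (h - 1)) / 2 - 3 / 2 * ln (h - 1) < y / q + ln y / 2 - 3 / 2 * ln h"
      unfolding \<Phi>_def cW y_def h_def r_def .
    moreover have le: "y \<le> r / (h - 1)" unfolding y_def using r0 h hq q by (intro divide_left_mono) auto
    then have "y / q \<le> r / (h - 1) / q" using q by (intro divide_right_mono) auto
    moreover have "ln y \<le> ln (r / (h - 1))" using le y0 by simp
    moreover have "ln (h - 1) \<le> ln h" using hq q by simp
    ultimately show False by linarith
  qed
  define t where "t a = card (N \<inter> S `` {a})" for a
  have tri: "3 / 2 * q\<^sup>2 / (q + 1) < (2 * (1 + real (t a)) - y) * (1 + q / (2 * (y - 1)))"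
    and tn: "real (t a) \<le> n - 1" if a: "a \<in> N" for a
  proof -
    have "N \<inter> S `` {a} \<subseteq> N - {a}" using S by (auto dest: rgraph_neD)
    then have "t a \<le> card (N - {a})" unfolding t_def using finN by (intro card_mono) auto
    moreover have "card N > 0" using a finN by (auto simp: card_gt_0_iff)
    ultimately show tn: "real (t a) \<le> n - 1" unfolding n_def using a by simp
    define d where "d = 2 * (1 + real (t a)) - y"
    have va: "(v, a) \<in> S" using a by (simp add: N_def)
    have dh: "d \<le> h - 1"
    proof -
      have "2 * (1 + real (t a)) \<le> 2 * n" using tn by simp
      then show ?thesis unfolding d_def using ny yh by linarith
    qed
    have "h * y = r" unfolding y_def using h by simp
    then have *: "r - 2 - 2 * real (t a) = (h - 1) * y - d" unfolding d_def by (simp add: algebra_simps)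
    have "(h - 1) * y - d \<ge> (h - 1) * (y - 1)" using dh by (simp add: algebra_simps)
    moreover have "(h - 1) * (y - 1) > 0" using hq yq q by (intro mult_pos_pos) auto
    \<comment> \<open>Positivity serves twice: the subtraction in the naturals is exact, and the
      contracted graph keeps the clause \<open>0 < r\<close> of \<open>P\<close>.\<close>
    ultimately have gt: "r - 2 - 2 * real (t a) > 0" using * by linarith
    then have "real (2 + 2 * t a) < real (card S)" unfolding r_def by simp
    then have lt: "2 + 2 * t a < card S" using of_nat_less_iff by blast
    then have c: "real (card S - 2 - 2 * t a) = (h - 1) * y - d"
      using * unfolding r_def by (simp add: of_nat_diff)
    have "\<Phi> (card W - 1) (card S - 2 - 2 * t a) < \<Phi> (card W) (card S)"
      using no[OF edges[OF va]] lt unfolding t_def N_def by simp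
    then have less: "((h - 1) * y - d) / (h - 1) / q + ln (((h - 1) * y - d) / (h - 1)) / 2 - 3 / 2 * ln (h - 1)
       < y / q + ln y / 2 - 3 / 2 * ln h"
      unfolding \<Phi>_def cW c unfolding y_def h_def r_def .
    have eq: "((h - 1) * y - d) / (h - 1) = y - d / (h - 1)" using hq q by (simp add: diff_divide_distrib)
    have "h \<ge> q + 1" using hq by simp
    from contraction_loss_bound[OF q yq this dh less[unfolded eq]]
    show "3 / 2 * q\<^sup>2 / (q + 1) < (2 * (1 + real (t a)) - y) * (1 + q / (2 * (y - 1)))"
      unfolding d_def .
  qed
  obtain a0 where a0: "a0 \<in> N" "\<And>a. a \<in> N \<Longrightarrow> t a0 \<le> t a"
    using Nne finN arg_min_if_finite[of N t] by (meson not_le)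
  define \<tau> where "\<tau> = t a0"
  note nb = neighbourhood_density_bound[OF q yq ny tn[OF a0(1)] tri[OF a0(1)], folded \<tau>_def]
  define T where "T = S \<inter> N \<times> N"
  have NW: "N \<subseteq> W" unfolding N_def using S by (auto dest: rgraph_inD)
  have T: "rgraph N T" unfolding T_def using S NW by (rule rgraph_restrict)
  have Tt: "T `` {a} = N \<inter> S `` {a}" if "a \<in> N" for a unfolding T_def using that by auto
  have deg: "\<tau> \<le> card (T `` {a})" if "a \<in> N" for a
    using a0(2)[OF that] Tt[OF that] unfolding \<tau>_def t_def by simp
  have "card E \<le> card N"
  proof -
    have "real (card E) < real (card N + 1)" using nb(1) unfolding q_def n_def by simp
    then show ?thesis using of_nat_less_iff by fastforce
  qed
  then have "card U \<le> card N" using U by simp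
  then obtain \<phi> where \<phi>: "inj_on \<phi> U" "\<phi> ` U \<subseteq> N"
    and bad: "card {e \<in> E. \<exists>x y. e = {x, y} \<and> (\<phi> x, \<phi> y) \<notin> T} * (card N - 1) \<le> card E * (card N - 1 - \<tau>)"
    by (rule injection_few_nonadjacent[OF T H _ deg])
  define b where "b = card {e \<in> E. \<exists>x y. e = {x, y} \<and> (\<phi> x, \<phi> y) \<notin> T}"
  have b: "real b \<le> 2 * real \<tau> - n + 4 - q"
  proof -
    have \<tau>n: "\<tau> \<le> card N - 1" using tn[OF a0(1)] unfolding n_def \<tau>_def[symmetric] by linarith
    have "real (b * (card N - 1)) \<le> real (card E * (card N - 1 - \<tau>))" using bad b_def of_nat_le_iff by metis
    moreover have "real (card N - 1) = n - 1" "real (card N - 1 - \<tau>) = n - 1 - real \<tau>"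
      using \<tau>n nb(2) unfolding n_def by (auto simp: of_nat_diff)
    ultimately have "real b * (n - 1) \<le> q * (n - 1 - real \<tau>)" unfolding q_def by simp
    also have "\<dots> \<le> (2 * real \<tau> - n + 4 - q) * (n - 1)" using nb(3) by (simp add: mult.commute)
    finally show ?thesis using nb(2) by simp
  qed
  have common: "card U + b \<le> card (T `` {x} \<inter> T `` {z}) + 2"
    if xz: "x \<in> N" "z \<in> N" "x \<noteq> z" "(x, z) \<notin> T" for x z
  proof -
    have zx: "(z, x) \<notin> T" using xz rgraph_symD[OF T] by blast
    have fin: "finite (T `` {x})" "finite (T `` {z})" using rgraph_finite_nbrs[OF T] by auto
    \<comment> \<open>Non-adjacency keeps \<open>x\<close> and \<open>z\<close> out of both
      neighbourhoods; this gives the 2 in \<open>card N - 2\<close>.\<close>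
    have "T `` {x} \<union> T `` {z} \<subseteq> N - {x, z}" using T xz zx by (auto dest: rgraph_inD rgraph_neD)
    then have "card (T `` {x} \<union> T `` {z}) \<le> card (N - {x, z})" using finN by (intro card_mono) auto
    also have "card (N - {x, z}) = card N - 2" using xz finN by (subst card_Diff_subset) auto
    finally have "card (T `` {x}) + card (T `` {z}) \<le> card N - 2 + card (T `` {x} \<inter> T `` {z})"
      using card_Un_Int[OF fin] by linarith
    moreover have "card N \<ge> 2" using xz finN card_mono[of N "{x, z}"] by auto
    moreover have "\<tau> \<le> card (T `` {x})" "\<tau> \<le> card (T `` {z})" using deg xz by auto
    ultimately have "2 * \<tau> + 2 \<le> card N + card (T `` {x} \<inter> T `` {z})" by linarith
    then have "real (2 * \<tau> + 2) \<le> real (card N + card (T `` {x} \<inter> T `` {z}))" using of_nat_le_iff by blast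
    moreover have "real (card U) \<le> q" using U by (simp add: q_def)
    ultimately have "real (card U + b) \<le> real (card (T `` {x} \<inter> T `` {z}) + 2)"
      using b unfolding n_def by simp
    then show ?thesis using of_nat_le_iff by blast
  qed
  obtain B where "model B U (edge_rel E) N T"
    using model_from_injection[OF T H \<phi>] common unfolding b_def by blast
  then have "model B U (edge_rel E) W S" using NW by (rule model_mono) (auto simp: T_def)
  moreover have "edge_rel E \<subseteq> U \<times> U" using rgraph_edge_rel[OF H(1)] by (simp add: rgraph_def)
  ultimately show thesis using model_trans[OF _ B0] that by blast
qed

section \<open>Forests\<close>

lemma card_edge_rel_nbrs:
  assumes "graph V E"
  shows "card (edge_rel E `` {v}) = degree E v"
proof -
  have "bij_betw (\<lambda>w. {v, w}) (edge_rel E `` {v}) {e \<in> E. v \<in> e}"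
    unfolding bij_betw_def
  proof
    show "inj_on (\<lambda>w. {v, w}) (edge_rel E `` {v})" by (auto simp: inj_on_def doubleton_eq_iff)
    show "(\<lambda>w. {v, w}) ` (edge_rel E `` {v}) = {e \<in> E. v \<in> e}"
    proof
      show "(\<lambda>w. {v, w}) ` (edge_rel E `` {v}) \<subseteq> {e \<in> E. v \<in> e}" by (auto simp: edge_rel_def)
      show "{e \<in> E. v \<in> e} \<subseteq> (\<lambda>w. {v, w}) ` (edge_rel E `` {v})"
      proof
        fix e assume e: "e \<in> {e \<in> E. v \<in> e}"
        then obtain x y where xy: "e = {x, y}" using graph_edge_obtain[OF assms, of e] by blast
        then consider "e = {v, y}" | "e = {v, x}" using e by auto
        then show "e \<in> (\<lambda>w. {v, w}) ` (edge_rel E `` {v})"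
          using e by cases (auto simp: edge_rel_def)
      qed
    qed
  qed
  then show ?thesis unfolding degree_def by (rule bij_betw_same_card)
qed

lemma card_edge_rel_le:
  assumes "graph V E" "finite E"
  shows "card (edge_rel E) \<le> 2 * card E"
proof -
  have le2: "card {(a, b). {a, b} = e} \<le> 2" if e: "e \<in> E" for e
  proof -
    obtain x y where "e = {x, y}" using graph_edge_obtain[OF assms(1) e] by blast
    then have "{(a, b). {a, b} = e} = {(x, y), (y, x)}" by (auto simp: doubleton_eq_iff)
    moreover have "card {(x, y), (y, x)} \<le> 2" by (intro card_insert_le_m1) auto
    ultimately show ?thesis by simp
  qed
  have "edge_rel E = (\<Union>e\<in>E. {(a, b). {a, b} = e})" by (auto simp: edge_rel_def)
  then have "card (edge_rel E) \<le> (\<Sum>e\<in>E. card {(a, b). {a, b} = e})"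
    using assms(2) by (simp add: card_UN_le)
  also have "\<dots> \<le> (\<Sum>e\<in>E. 2)" using le2 by (rule sum_mono)
  finally show ?thesis by simp
qed

lemma finite_edges: "graph V E \<Longrightarrow> finite E"
  unfolding graph_def by (meson PowI finite_Pow_iff finite_subset subsetI)

text \<open>Acyclicity is encoded as a construction order in which each new vertex is isolated or a
  leaf, so that rule induction is the greedy embedding.\<close>

inductive forest :: "'b set \<Rightarrow> 'b set set \<Rightarrow> bool" where
  forest_empty: "forest {} {}"
| forest_isolated: "forest V E \<Longrightarrow> x \<notin> V \<Longrightarrow> forest (insert x V) E"
| forest_leaf: "forest V E \<Longrightarrow> x \<notin> V \<Longrightarrow> y \<in> V \<Longrightarrow> forest (insert x V) (insert {x, y} E)"

lemma forest_graph: "forest V E \<Longrightarrow> graph V E"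
proof (induction rule: forest.induct)
  case (forest_leaf V E x y)
  then have "card {x, y} = 2" by (auto simp: card_insert_if)
  then show ?case using forest_leaf by (auto simp: graph_def)
qed (auto simp: graph_def)

lemma forest_embedding:
  assumes "forest U E" "rgraph V R" "V \<noteq> {}" "\<And>v. v \<in> V \<Longrightarrow> card U \<le> card (R `` {v})"
  shows "\<exists>\<phi>. inj_on \<phi> U \<and> \<phi> ` U \<subseteq> V \<and> (\<forall>x y. {x, y} \<in> E \<longrightarrow> (\<phi> x, \<phi> y) \<in> R)"
  using assms
proof (induction rule: forest.induct)
  case forest_empty
  then show ?case by auto
next
  case (forest_isolated U E x)
  have g: "graph U E" using forest_isolated by (simp add: forest_graph)
  then have fin: "finite U" by (simp add: graph_def)
  have deg: "card U < card (R `` {v})" if "v \<in> V" for v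
    using forest_isolated.prems(3)[OF that] forest_isolated.hyps fin by simp
  then obtain \<phi> where \<phi>: "inj_on \<phi> U" "\<phi> ` U \<subseteq> V" "\<forall>x y. {x, y} \<in> E \<longrightarrow> (\<phi> x, \<phi> y) \<in> R"
    using forest_isolated.IH forest_isolated.prems by (meson less_imp_le)
  obtain v where v: "v \<in> V" using forest_isolated.prems by auto
  have "card (\<phi> ` U) < card (R `` {v})" using deg[OF v] card_image_le[OF fin, of \<phi>] by linarith
  then have "\<not> R `` {v} \<subseteq> \<phi> ` U" using fin by (meson card_mono finite_imageI not_le)
  then obtain w where w: "w \<in> V" "w \<notin> \<phi> ` U" using forest_isolated.prems(1) by (auto dest: rgraph_inD)
  have nx: "a \<noteq> x \<and> b \<noteq> x" if "{a, b} \<in> E" for a b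
    using that g forest_isolated.hyps by (auto simp: graph_def)
  show ?case
  proof (intro exI[of _ "\<phi>(x := w)"] conjI)
    show "inj_on (\<phi>(x := w)) (insert x U)" using \<phi> w forest_isolated.hyps by (auto simp: inj_on_def)
    show "(\<phi>(x := w)) ` insert x U \<subseteq> V" using \<phi> w by auto
    show "\<forall>a b. {a, b} \<in> E \<longrightarrow> ((\<phi>(x := w)) a, (\<phi>(x := w)) b) \<in> R" using \<phi>(3) nx by auto
  qed
next
  case (forest_leaf U E x y)
  have g: "graph U E" using forest_leaf by (simp add: forest_graph)
  then have fin: "finite U" by (simp add: graph_def)
  have deg: "card U < card (R `` {v})" if "v \<in> V" for v
    using forest_leaf.prems(3)[OF that] forest_leaf.hyps fin by simp
  then obtain \<phi> where \<phi>: "inj_on \<phi> U" "\<phi> ` U \<subseteq> V" "\<forall>x y. {x, y} \<in> E \<longrightarrow> (\<phi> x, \<phi> y) \<in> R"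
    using forest_leaf.IH forest_leaf.prems by (meson less_imp_le)
  have y: "\<phi> y \<in> V" using forest_leaf.hyps \<phi> by auto
  have "card (\<phi> ` U) < card (R `` {\<phi> y})" using deg[OF y] card_image_le[OF fin, of \<phi>] by linarith
  then have "\<not> R `` {\<phi> y} \<subseteq> \<phi> ` U" using fin by (meson card_mono finite_imageI not_le)
  then obtain w where w: "(\<phi> y, w) \<in> R" "w \<notin> \<phi> ` U" by auto
  have w': "w \<in> V" "(w, \<phi> y) \<in> R" using w forest_leaf.prems(1) by (auto dest: rgraph_inD rgraph_symD)
  have nx: "a \<noteq> x \<and> b \<noteq> x" if "{a, b} \<in> E" for a b
    using that g forest_leaf.hyps by (auto simp: graph_def)
  show ?case
  proof (intro exI[of _ "\<phi>(x := w)"] conjI)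
    show "inj_on (\<phi>(x := w)) (insert x U)" using \<phi> w forest_leaf.hyps by (auto simp: inj_on_def)
    show "(\<phi>(x := w)) ` insert x U \<subseteq> V" using \<phi> w' by auto
    have "y \<noteq> x" using forest_leaf.hyps by auto
    then show "\<forall>a b. {a, b} \<in> insert {x, y} E \<longrightarrow> ((\<phi>(x := w)) a, (\<phi>(x := w)) b) \<in> R"
      using \<phi>(3) nx w w' by (auto simp: doubleton_eq_iff)
  qed
qed

text \<open>Vertices of degree at most 1 are stripped off and put back: a leaf joins the side of its
  neighbour, where it adds one vertex and one edge, and an isolated vertex joins the forest. Once
  none is left to strip, minimum degree 2 gives at least as many edges as vertices.\<close>

lemma decompose_dense_forest:
  assumes "graph V E"
  shows "\<exists>V1 V2 E1 E2. V = V1 \<union> V2 \<and> V1 \<inter> V2 = {} \<and> E = E1 \<union> E2 \<and> graph V1 E1 \<and>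
    card V1 \<le> card E1 \<and> forest V2 E2"
  using assms
proof (induction "card V" arbitrary: V E rule: less_induct)
  case less
  have fin: "finite V" using less.prems by (simp add: graph_def)
  have finE: "finite E" using less.prems by (rule finite_edges)
  let ?N = "\<lambda>x. edge_rel E `` {x}"
  show ?case
  proof (cases "\<forall>x\<in>V. 2 \<le> card (?N x)")
    case True
    then have "(\<Sum>x\<in>V. 2) \<le> (\<Sum>x\<in>V. card (?N x))" by (intro sum_mono) auto
    also have "\<dots> = card (edge_rel E)"
      using card_rgraph_eq_sum[OF rgraph_edge_rel[OF less.prems]] by simp
    also have "\<dots> \<le> 2 * card E" using less.prems finE by (rule card_edge_rel_le)
    finally have "card V \<le> card E" by simp
    then show ?thesis using less.prems forest_empty
      by (intro exI[of _ V] exI[of _ "{}"] exI[of _ E] exI[of _ "{}"]) auto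
  next
    case False
    then obtain x where x: "x \<in> V" "card (?N x) < 2" by force
    let ?E = "{e \<in> E. x \<notin> e}"
    have g': "graph (V - {x}) ?E" using less.prems by (auto simp: graph_def)
    have "card (V - {x}) < card V" using fin x(1) by (rule card_Diff1_less)
    then obtain V1 V2 E1 E2 where IH: "V - {x} = V1 \<union> V2" "V1 \<inter> V2 = {}" "?E = E1 \<union> E2"
      "graph V1 E1" "card V1 \<le> card E1" "forest V2 E2"
      using less.hyps[OF _ g'] by metis
    have V: "V = insert x (V1 \<union> V2)" "x \<notin> V1" "x \<notin> V2" using IH(1) x by auto
    have finN: "finite (?N x)" using rgraph_finite_nbrs[OF rgraph_edge_rel[OF less.prems]] .
    show ?thesis
    proof (cases "?N x = {}")
      case True
      have "x \<notin> e" if e: "e \<in> E" for e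
      proof
        assume "x \<in> e"
        obtain a b where "e = {a, b}" using graph_edge_obtain[OF less.prems e] by blast
        then have "e = {x, b} \<or> e = {x, a}" using \<open>x \<in> e\<close> by auto
        then show False using True e by (auto simp: edge_rel_def)
      qed
      then have "E = E1 \<union> E2" using IH(3) by blast
      moreover have "V = V1 \<union> insert x V2" "V1 \<inter> insert x V2 = {}" using V IH(2) by auto
      ultimately show ?thesis using IH(4,5) forest_isolated[OF IH(6) V(3)] by blast
    next
      case False
      then have "card (?N x) \<noteq> 0" using finN by simp
      then have "card (?N x) = 1" using x by linarith
      then obtain y where y: "?N x = {y}" using card_1_singletonE by blast
      then have xy: "{x, y} \<in> E" by (auto simp: edge_rel_def)
      then have yV: "y \<in> V" "y \<noteq> x" using less.prems by (auto simp: graph_def)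
      have "e = {x, y}" if e: "e \<in> E" "x \<in> e" for e
      proof -
        obtain a b where "e = {a, b}" using graph_edge_obtain[OF less.prems e(1)] by blast
        then consider "e = {x, b}" | "e = {x, a}" using e(2) by auto
        then show ?thesis using y e(1) by cases (auto simp: edge_rel_def)
      qed
      then have E: "E = insert {x, y} (E1 \<union> E2)" using IH(3) xy by blast
      show ?thesis
      proof (cases "y \<in> V1")
        case True
        have "{x, y} \<notin> E1" using IH(4) V(2) by (auto simp: graph_def)
        then have "card (insert {x, y} E1) = card E1 + 1" using finite_edges[OF IH(4)] by simp
        moreover have "card (insert x V1) = card V1 + 1" using IH(4) V(2) by (simp add: graph_def)
        moreover have "graph (insert x V1) (insert {x, y} E1)"
          using IH(4) True yV by (auto simp: graph_def card_insert_if)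
        ultimately have "graph (insert x V1) (insert {x, y} E1)" "card (insert x V1) \<le> card (insert {x, y} E1)"
          using IH(5) by auto
        moreover have "V = insert x V1 \<union> V2" "insert x V1 \<inter> V2 = {}" "E = insert {x, y} E1 \<union> E2"
          using V IH(2) E by auto
        ultimately show ?thesis using IH(6) by blast
      next
        case False
        then have "y \<in> V2" using yV V by auto
        then have "forest (insert x V2) (insert {x, y} E2)" using forest_leaf[OF IH(6) V(3)] by blast
        moreover have "V = V1 \<union> insert x V2" "V1 \<inter> insert x V2 = {}" "E = E1 \<union> insert {x, y} E2"
          using V IH(2) E by auto
        ultimately show ?thesis using IH(4,5) by blast
      qed
    qed
  qed
qed

text \<open>A simple graph on at most two vertices has at most one edge. The bound 3 limits the
  relative cost of rounding in \<open>potential_large\<close>.\<close>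

lemma three_le_card_edges:
  assumes g: "graph V E" and le: "card V \<le> card E" and ne: "E \<noteq> {}"
  shows "3 \<le> card E"
proof (rule ccontr)
  assume "\<not> 3 \<le> card E"
  then have V2: "card V \<le> 2" using le by simp
  have fin: "finite V" using g by (simp add: graph_def)
  have e: "e = V \<and> card V = 2" if "e \<in> E" for e
  proof -
    have "e \<subseteq> V" "card e = 2" using g that by (auto simp: graph_def)
    then show ?thesis using card_seteq[OF fin] V2 by metis
  qed
  then have "E \<subseteq> {V}" by blast
  then have "card E \<le> 1" using card_mono[of "{V}" E] by simp
  then show False using e ne le by fastforce
qed

lemma card_vertices_le_twice_edges:
  assumes g: "graph V E" and cov: "\<And>x. x \<in> V \<Longrightarrow> \<exists>e\<in>E. x \<in> e"
  shows "card V \<le> 2 * card E"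
proof -
  have "V \<subseteq> \<Union>E" using cov by blast
  moreover have "finite (\<Union>E)" using g finite_edges[OF g] by (auto simp: graph_def intro: finite_subset)
  ultimately have "card V \<le> card (\<Union>E)" by (rule card_mono[rotated])
  also have "\<dots> \<le> (\<Sum>e\<in>E. card e)" using card_Union_le_sum_card .
  also have "\<dots> = 2 * card E" using g by (simp add: graph_def)
  finally show ?thesis .
qed

text \<open>The forest, with \<open>p\<close> edges and \<open>r\<close> vertices, takes
  \<open>r\<close> from the degree but is paid for in the factor \<open>q + p\<close>. Scaled by
  \<open>q\<close> it becomes \<open>w\<close> and \<open>s\<close>, which add more to
  \<open>y / q\<close> than to the bound for \<open>3 / 2 * ln (h / q)\<close>. This reduces the
  claim to a numerical inequality.\<close>

lemma potential_large:
  fixes q p r y h :: real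
  assumes q: "q \<ge> 3" "p \<ge> 0" "r \<le> 2 * p" and y: "y \<ge> 6929 / 2000 * (q + p) - r"
    and h: "0 < h" "h \<le> 6929 / 1000 * (q + p) + 2 - r"
  shows "1 - ln q < y / q + ln y / 2 - 3 / 2 * ln h"
proof -
  define w where "w = p / q"
  define s where "s = (2 * p - r) / q"
  \<comment> \<open>Chosen so that \<open>38 / 5 * (1 + u)\<close> bounds \<open>h / q\<close> while
    \<open>3 / 2 * u = 21 / 20 * w + 3 / 10 * s\<close> stays below the gain
    \<open>2929 / 2000 * w + s\<close> in \<open>y / q\<close>.\<close>
  define u where "u = 7 / 10 * w + 1 / 5 * s"
  have ws: "w \<ge> 0" "s \<ge> 0" "u \<ge> 0" unfolding u_def w_def s_def using q by auto
  have p: "p = q * w" "r = 2 * (q * w) - q * s" unfolding w_def s_def using q by auto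
  have "q * (6929 / 2000 + 2929 / 2000 * w + s) = 6929 / 2000 * (q + q * w) - (2 * (q * w) - q * s)"
    by (simp add: field_simps)
  then have "q * (6929 / 2000 + 2929 / 2000 * w + s) \<le> y" using y unfolding p by simp
  then have Y: "6929 / 2000 + 2929 / 2000 * w + s \<le> y / q" using q by (simp add: le_divide_eq mult.commute)
  \<comment> \<open>By \<open>q \<ge> 3\<close> the additive 2 is at most \<open>2 / 3 * q\<close>,
    and \<open>6.929 + 2 / 3 < 38 / 5\<close>.\<close>
  have "h \<le> q * (38 / 5 * (1 + u))"
  proof -
    have nn: "q * w \<ge> 0" "q * s \<ge> 0" using q ws by auto
    have "q * (38 / 5 * (1 + u)) = 38 / 5 * q + 133 / 25 * (q * w) + 38 / 25 * (q * s)"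
      unfolding u_def by (simp add: field_simps)
    moreover have "6929 / 1000 * (q + q * w) + 2 - (2 * (q * w) - q * s)
        = 6929 / 1000 * q + 2 + 4929 / 1000 * (q * w) + q * s"
      by (simp add: field_simps)
    ultimately show ?thesis using h(2) q(1) nn unfolding p by linarith
  qed
  then have hq: "h / q \<le> 38 / 5 * (1 + u)" using q by (simp add: divide_le_eq mult.commute)
  have "ln (h / q) \<le> ln (38 / 5 * (1 + u))" using q h by (intro ln_mono hq) auto
  also have "\<dots> = ln (38 / 5) + ln (1 + u)" using ws by (intro ln_mult_pos) auto
  also have "\<dots> \<le> ln (38 / 5) + u" using ws by (intro add_left_mono ln_add_one_self_le_self) auto
  finally have lnh: "ln h - ln q \<le> ln (38 / 5) + u" using q h by (simp add: ln_div)
  have yq: "173 / 50 \<le> y / q" using Y ws by linarith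
  then have "y / q > 0" by linarith
  then have "y > 0" using q by (simp add: zero_less_divide_iff)
  have "ln (173 / 50) \<le> ln (y / q)" using yq by (intro ln_mono) auto
  then have lny: "ln (173 / 50) \<le> ln y - ln q" using q \<open>y > 0\<close> by (simp add: ln_div)
  \<comment> \<open>Any bound below \<open>2 * (6929 / 2000 - 1) = 4.929\<close> would do, and
    \<open>616 / 125 = 4.928\<close>. The quadratic Taylor bound for \<open>exp\<close> is accurate
    enough at one sixteenth of this.\<close>
  have num: "3 * ln (38 / 5) - ln (173 / 50) \<le> (616 / 125 :: real)"
  proof -
    have "(1 + 77 / 250 + (77 / 250)\<^sup>2 / 2 :: real) \<le> exp (77 / 250)"
      by (rule exp_lower_Taylor_quadratic) simp
    then have "(1 + 77 / 250 + (77 / 250)\<^sup>2 / 2 :: real) ^ 16 \<le> exp (77 / 250) ^ 16"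
      by (intro power_mono) auto
    also have "\<dots> = exp (616 / 125)" by (simp flip: exp_of_nat_mult)
    finally have le: "(1 + 77 / 250 + (77 / 250)\<^sup>2 / 2 :: real) ^ 16 \<le> exp (616 / 125)" .
    have "(38 / 5) ^ 3 / (173 / 50) \<le> (1 + 77 / 250 + (77 / 250)\<^sup>2 / 2 :: real) ^ 16"
      by (simp add: power_divide divide_simps)
    then have "(38 / 5) ^ 3 / (173 / 50) \<le> exp (616 / 125 :: real)" using le by (rule order_trans)
    then have "ln ((38 / 5) ^ 3 / (173 / 50)) \<le> ln (exp (616 / 125 :: real))"
      by (intro ln_mono) auto
    moreover have "ln ((38 / 5) ^ 3 / (173 / 50)) = ln ((38 / 5) ^ 3) - ln (173 / 50 :: real)"
      by (subst ln_div) auto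
    moreover have "ln ((38 / 5) ^ 3) = 3 * ln (38 / 5 :: real)" by (simp add: ln_realpow)
    ultimately show ?thesis by simp
  qed
  show ?thesis using num lnh lny Y ws unfolding u_def by argo
qed

section \<open>Proof of the theorem\<close>

text \<open>In the application \<open>K\<close> is half the average degree of a minor, far above
  \<open>k = 6929 / 2000 * (card E + p)\<close> when \<open>H\<close> has many isolated vertices.
  Passing to about \<open>2 * k - r\<close> vertices without loss of density leaves room for these
  and keeps the order small enough for the potential.\<close>

lemma model_in_dense_part:
  fixes p r :: nat and K :: real
  assumes T: "rgraph L T" "L \<noteq> {}" and H: "graph U E" "card U \<le> card E" "E \<noteq> {}"
    and r: "r \<le> 2 * p" and K: "6929 / 2000 * real (card E + p) \<le> K"
    and deg: "\<And>v. v \<in> L \<Longrightarrow> K - real r \<le> real (card (T `` {v}))"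
    and size: "real (card L) \<le> 2 * K + 1 - real r"
  obtains M B where "M \<subseteq> L" "card M + r \<le> nat \<lceil>6929 / 1000 * real (card E + p)\<rceil> + 1"
    "model B U (edge_rel E) M T"
proof -
  define q where "q = real (card E)"
  define k where "k = 6929 / 2000 * (q + real p)"
  define c where "c = nat \<lceil>6929 / 1000 * real (card E + p)\<rceil>"
  define m where "m = c + 1 - r"
  have finE: "finite E" using H(1) by (rule finite_edges)
  have q3: "card E \<ge> 3" using H by (rule three_le_card_edges)
  then have q: "q \<ge> 3" by (simp add: q_def)
  have p: "real p \<ge> 0" "real r \<le> 2 * real p" using r by auto
  have kK: "k \<le> K" using K by (simp add: k_def q_def)
  have kr: "k - real r \<ge> q" unfolding k_def using p q by argo
  have c: "2 * k \<le> real c" "real c \<le> 2 * k + 1"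
  proof -
    have eq: "6929 / 1000 * real (card E + p) = 2 * k" unfolding k_def q_def by simp
    have "0 \<le> 2 * k" using kr q by simp
    then have "real c = of_int \<lceil>2 * k\<rceil>" unfolding c_def eq by simp
    then show "2 * k \<le> real c" "real c \<le> 2 * k + 1" by linarith+
  qed
  have rc: "r \<le> c"
  proof -
    have "real r \<le> real c" using c(1) kr q by linarith
    then show ?thesis by simp
  qed
  have m: "real m = real c + 1 - real r" "m \<ge> 1" unfolding m_def using rc by auto
  have finL: "finite L" using T by (simp add: rgraph_def)
  then have L0: "card L > 0" using T(2) by (simp add: card_gt_0_iff)
  have "(\<Sum>v\<in>L. K - real r) \<le> (\<Sum>v\<in>L. real (card (T `` {v})))" using deg by (rule sum_mono)
  then have cT: "real (card L) * (K - real r) \<le> real (card T)"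
    using card_rgraph_eq_sum[OF T(1)] by simp
  obtain M where M: "M \<subseteq> L" "card M \<le> m" "card M > 0"
    "real (card M) * (k - real r) \<le> real (card (T \<inter> M \<times> M))"
  proof (cases "card L \<le> m")
    case True
    have "T \<inter> L \<times> L = T" using T by (auto simp: rgraph_def)
    moreover have "real (card L) * (k - real r) \<le> real (card L) * (K - real r)"
      using kK by (intro mult_left_mono) auto
    then have "real (card L) * (k - real r) \<le> real (card T)" using cT by (rule order_trans)
    ultimately show thesis using that[of L] True L0 by simp
  next
    case False
    then obtain M where M: "M \<subseteq> L" "card M = m"
      "card T * (m * (m - 1)) \<le> card (T \<inter> M \<times> M) * (card L * (card L - 1))"
      using dense_induced_subgraph[OF T(1), of m] m(2) by auto
    define l where "l = real (card L)"
    have l: "l > 0" "real (card L - 1) = l - 1" "l > 1" using L0 False m(2) unfolding l_def by (auto simp: of_nat_diff)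
    have m1: "real (m - 1) = real m - 1" using m(2) by (simp add: of_nat_diff)
    have "real (card T * (m * (m - 1))) \<le> real (card (T \<inter> M \<times> M) * (card L * (card L - 1)))"
      using M(3) of_nat_le_iff by blast
    then have A: "real (card T) * (real m * (real m - 1)) \<le> real (card (T \<inter> M \<times> M)) * (l * (l - 1))"
      using l(2) m1 unfolding l_def by simp
    have "(l * (K - real r)) * (real m * (real m - 1)) \<le> real (card T) * (real m * (real m - 1))"
      using cT m(2) unfolding l_def by (intro mult_right_mono) auto
    then have "l * ((K - real r) * (real m * (real m - 1))) \<le> l * (real (card (T \<inter> M \<times> M)) * (l - 1))"
      using A by (simp add: mult.assoc mult.left_commute)
    then have B: "(K - real r) * (real m * (real m - 1)) \<le> real (card (T \<inter> M \<times> M)) * (l - 1)"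
      using l(1) by simp
    \<comment> \<open>The density of \<open>L\<close> is at least
      \<open>(K - r) / (2 * K - r)\<close>, which does not decrease in \<open>K\<close>. Its value
      at \<open>K = k\<close>, together with \<open>m - 1 \<ge> 2 * k - r\<close>, gives average
      degree at least \<open>k - r\<close> on \<open>M\<close>.\<close>
    have "(k - real r) * (l - 1) \<le> (k - real r) * (2 * K - real r)"
      using kr q size unfolding l_def by (intro mult_left_mono) auto
    also have "\<dots> \<le> (K - real r) * (2 * k - real r)"
    proof -
      have "k * real r \<le> K * real r" using kK by (intro mult_right_mono) auto
      then show ?thesis by (simp add: algebra_simps)
    qed
    also have "\<dots> \<le> (K - real r) * (real m - 1)"
      using kr kK q c m(1) by (intro mult_left_mono) auto
    finally have "real m * ((k - real r) * (l - 1)) \<le> real m * ((K - real r) * (real m - 1))"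
      by (intro mult_left_mono) auto
    then have "(real m * (k - real r)) * (l - 1) \<le> real (card (T \<inter> M \<times> M)) * (l - 1)"
      using B by (simp add: mult.assoc mult.left_commute)
    then have "real m * (k - real r) \<le> real (card (T \<inter> M \<times> M))" using l(3) by simp
    then show thesis using that[of M] M m(2) by simp
  qed
  define S where "S = T \<inter> M \<times> M"
  define y where "y = real (card S) / real (card M)"
  have S: "rgraph M S" unfolding S_def using T(1) M(1) by (rule rgraph_restrict)
  have yk: "y \<ge> k - real r" unfolding y_def S_def using M by (simp add: le_divide_eq mult.commute)
  have "real (card S) \<le> real (card M * (card M - 1))" using card_rgraph_le[OF S] of_nat_le_iff by blast
  then have "y \<le> real (card M) - 1"
    unfolding y_def using M(3) by (simp add: divide_le_eq of_nat_diff mult.commute)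
  then have qM: "card E \<le> card M" using yk kr unfolding q_def by linarith
  have "y > 0" using yk kr q by linarith
  then have S0: "S \<noteq> {}" unfolding y_def by auto
  have hM: "real (card M) \<le> 6929 / 1000 * (q + real p) + 2 - real r"
  proof -
    have "real (card M) \<le> real m" using M(2) by simp
    then show ?thesis using m(1) c(2) unfolding k_def by argo
  qed
  have "1 - ln q < y / q + ln y / 2 - 3 / 2 * ln (real (card M))"
    using potential_large[OF q p yk[unfolded k_def] _ hM] M(3) by simp
  then have pot: "1 - ln (real (card E)) < real (card S) / real (card M) / real (card E)
      + ln (real (card S) / real (card M)) / 2 - 3 / 2 * ln (real (card M))"
    unfolding y_def q_def .
  have "2 \<le> card E" using q3 by simp
  then obtain B where "model B U (edge_rel E) M S"
    using model_of_large_potential[OF S H(1) finE H(2) _ qM S0 pot] by blast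
  then have "model B U (edge_rel E) M T" by (rule model_mono) (auto simp: S_def)
  moreover have "card M + r \<le> c + 1" using M(2) rc unfolding m_def by linarith
  ultimately show thesis using that M(1) unfolding c_def by blast
qed

text \<open>A graph of average degree at least \<open>i + 6.929 q\<close> has more than \<open>i + 6.929 q\<close> vertices. Hence
  \<open>i\<close> vertices remain for the isolated ones if everything else is placed on \<open>\<lceil>6.929 q\<rceil> + 1\<close> vertices.\<close>
lemma model_of_average_degree:
  fixes VH :: "'b set" and V :: "'a set"
  assumes H: "graph VH EH" "0 < real (card (isolated_vertices VH EH)) + 6929 / 1000 * real (card EH)"
    and R: "rgraph V R" "V \<noteq> {}"
    and avg: "(real (card (isolated_vertices VH EH)) + 6929 / 1000 * real (card EH)) * real (card V) \<le> real (card R)"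
  obtains B where "model B VH (edge_rel EH) V R"
proof -
  define I where "I = isolated_vertices VH EH"
  define i where "i = real (card I)"
  define q where "q = real (card EH)"
  define \<kappa>0 where "\<kappa>0 = i + 6929 / 1000 * q"
  have finH: "finite VH" using H(1) by (simp add: graph_def)
  have I: "I \<subseteq> VH" unfolding I_def isolated_vertices_def by auto
  then have finI: "finite I" using finH finite_subset by blast
  have iq: "i \<ge> 0" "q \<ge> 0" by (auto simp: i_def q_def)
  have \<kappa>0: "\<kappa>0 > 0" using H(2) by (simp add: \<kappa>0_def i_def q_def I_def)
  have "graph (VH - I) EH"
    using H(1) unfolding graph_def I_def isolated_vertices_def by auto
  then obtain V1 V2 E1 E2 where dec: "VH - I = V1 \<union> V2" "V1 \<inter> V2 = {}" "EH = E1 \<union> E2" "graph V1 E1"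
    "card V1 \<le> card E1" "forest V2 E2"
    using decompose_dense_forest by metis
  have g2: "graph V2 E2" using dec(6) by (rule forest_graph)
  have fin: "finite E1" "finite E2" "finite V1" "finite V2"
    using dec(4) g2 finite_edges by (auto simp: graph_def)
  have "E1 \<inter> E2 = {}"
  proof -
    have "e = {}" if "e \<in> E1" "e \<in> E2" for e
      using that dec(2,4) g2 unfolding graph_def by blast
    then show ?thesis using dec(4) unfolding graph_def by fastforce
  qed
  then have qsum: "card EH = card E1 + card E2" using dec(3) fin by (simp add: card_Un_disjoint)
  define r where "r = card V2"
  \<comment> \<open>Vertices of \<open>V2\<close> are not isolated in \<open>H\<close>, and their
    edges cannot lie in \<open>E1\<close>, so \<open>E2\<close> covers \<open>V2\<close>.\<close>
  have r: "r \<le> 2 * card E2"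
    unfolding r_def
  proof (rule card_vertices_le_twice_edges[OF g2])
    fix x assume x: "x \<in> V2"
    then have "x \<in> VH" "x \<notin> I" using dec(1) by auto
    then obtain e where e: "e \<in> EH" "x \<in> e" unfolding I_def isolated_vertices_def by auto
    then have "e \<notin> E1" using dec(2,4) x unfolding graph_def by blast
    then show "\<exists>e\<in>E2. x \<in> e" using e dec(3) by blast
  qed
  define P where "P h s \<longleftrightarrow> 1 \<le> h \<and> \<kappa>0 * real h \<le> real s" for h s :: nat
  have "card V \<ge> 1" using R by (simp add: rgraph_def Suc_leI card_gt_0_iff)
  then have "P (card V) (card R)" unfolding P_def \<kappa>0_def i_def q_def I_def using avg by simp
  then obtain W :: "'a set" and S B0 where S: "rgraph W S" and B0: "model B0 W S V R" and PW: "P (card W) (card S)"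
    and edges: "\<And>u v. (u, v) \<in> S \<Longrightarrow> \<not> P (card W - 1) (card S - 2 - 2 * card (S `` {u} \<inter> S `` {v}))"
    and verts: "\<And>v. v \<in> W \<Longrightarrow> \<not> P (card W - 1) (card S - 2 * card (S `` {v}))"
    using minimal_minor[OF R(1), of P] by metis
  define h where "h = real (card W)"
  define s where "s = real (card S)"
  define K where "K = s / h / 2"
  have W1: "card W \<ge> 1" using PW by (simp add: P_def)
  have h0: "h > 0" using W1 by (simp add: h_def)
  have s: "\<kappa>0 * h \<le> s" using PW by (simp add: P_def h_def s_def)
  have sK: "s = 2 * K * h" unfolding K_def using h0 by simp
  have K: "\<kappa>0 \<le> 2 * K" unfolding K_def using s h0 by (simp add: le_divide_eq)
  have "real (card S) \<le> real (card W * (card W - 1))" using card_rgraph_le[OF S] of_nat_le_iff by blast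
  then have Kh: "2 * K \<le> h - 1"
    unfolding K_def h_def s_def using W1 by (simp add: divide_le_eq of_nat_diff mult.commute)
  then have "h > 1" using K \<kappa>0 by linarith
  then have W2: "1 \<le> card W - 1" unfolding h_def by linarith
  then have cW: "real (card W - 1) = h - 1" unfolding h_def by linarith
  \<comment> \<open>Losing one vertex and at most \<open>2 * K\<close> of the degree sum would keep
    the average degree at least \<open>2 * K\<close>. For a deletion \<open>x\<close> is the degree,
    for a contraction one more than the number of triangles.\<close>
  have no: "K < real x" if "\<not> P (card W - 1) (card S - 2 * x)" for x
  proof -
    have "real (card S - 2 * x) < \<kappa>0 * (h - 1)" using that W2 cW unfolding P_def by auto
    moreover have "s - 2 * real x \<le> real (card S - 2 * x)" unfolding s_def by linarith
    moreover have "\<kappa>0 * (h - 1) \<le> 2 * K * (h - 1)" using K \<open>h > 1\<close> by (intro mult_right_mono) auto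
    moreover have "2 * K * (h - 1) = s - 2 * K" using sK by (simp add: algebra_simps)
    ultimately show ?thesis by linarith
  qed
  have "W \<noteq> {}" using W1 by auto
  then obtain v where v: "v \<in> W" "card W * card (S `` {v}) \<le> card S"
    using obtains_min_degree_vertex[OF S] by blast
  define N where "N = S `` {v}"
  define D where "D = insert v N"
  define T where "T = S \<inter> D \<times> D"
  have finN: "finite N" unfolding N_def using S by (rule rgraph_finite_nbrs)
  have vN: "v \<notin> N" unfolding N_def using S by (auto dest: rgraph_neD)
  have DW: "D \<subseteq> W" unfolding D_def N_def using v S by (auto dest: rgraph_inD)
  have T: "rgraph D T" unfolding T_def using S DW by (rule rgraph_restrict)
  have finD: "finite D" using finN by (simp add: D_def)
  have "real (card W * card N) \<le> s" using v(2) unfolding N_def s_def of_nat_le_iff .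
  then have "real (card N) \<le> 2 * K" unfolding K_def using h0 by (simp add: h_def le_divide_eq mult.commute)
  then have cD: "real (card D) \<le> 2 * K + 1" unfolding D_def using finN vN by simp
  have degD: "K < real (card (T `` {a}))" if a: "a \<in> D" for a
  proof (cases "a = v")
    case True
    then have "T `` {a} = N" unfolding T_def D_def N_def by auto
    then show ?thesis using no[OF verts[OF v(1)]] by (simp add: N_def)
  next
    case False
    then have va: "(v, a) \<in> S" using a by (simp add: D_def N_def)
    \<comment> \<open>In the closed neighbourhood \<open>v\<close> itself is a further neighbour of
      \<open>a\<close>, which matches the 1 that a contraction adds to its triangles.\<close>
    have "insert v (N \<inter> S `` {a}) \<subseteq> T `` {a}"
      unfolding T_def using a va S by (auto simp: D_def dest: rgraph_symD)
    then have "card (insert v (N \<inter> S `` {a})) \<le> card (T `` {a})"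
      using rgraph_finite_nbrs[OF T] by (rule card_mono[rotated])
    moreover have "card (insert v (N \<inter> S `` {a})) = 1 + card (N \<inter> S `` {a})" using finN vN by simp
    moreover have "K < real (1 + card (N \<inter> S `` {a}))"
      using no[of "1 + card (N \<inter> S `` {a})"] edges[OF va] unfolding N_def by simp
    ultimately show ?thesis by linarith
  qed
  have qq: "q = real (card E1 + card E2)" "q \<ge> real (card E2)" using qsum by (auto simp: q_def)
  have Kq: "6929 / 2000 * q \<le> K" using K iq unfolding \<kappa>0_def by argo
  have rK: "real r \<le> K"
  proof -
    have "real r \<le> 2 * real (card E2)" using r by simp
    then show ?thesis using Kq qq(2) iq(2) by argo
  qed
  have "card V2 \<le> card (T `` {a})" if "a \<in> D" for a
    using degD[OF that] rK unfolding r_def by linarith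
  moreover have "D \<noteq> {}" by (simp add: D_def)
  ultimately obtain \<phi> where \<phi>: "inj_on \<phi> V2" "\<phi> ` V2 \<subseteq> D" "\<forall>x y. {x, y} \<in> E2 \<longrightarrow> (\<phi> x, \<phi> y) \<in> T"
    using forest_embedding[OF dec(6) T] by blast
  define X where "X = \<phi> ` V2"
  have cX: "card X = r" unfolding X_def r_def using \<phi>(1) by (rule card_image)
  have finX: "finite X" using fin by (simp add: X_def)
  have m2: "model (\<lambda>x. {\<phi> x}) V2 (edge_rel E2) X S"
    using \<phi> by (intro model_singletons) (auto simp: X_def edge_rel_def T_def)
  define c where "c = nat \<lceil>6929 / 1000 * real (card E1 + card E2)\<rceil>"
  obtain M B1 where M: "M \<subseteq> D - X" "card M + r \<le> c + 1" and m1: "model B1 V1 (edge_rel E1) M S"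
  \<comment> \<open>\<open>model_in_dense_part\<close> needs an edge; if there is none, only the
    size bound for the forest remains.\<close>
  proof (cases "E1 = {}")
    case True
    then have "V1 = {}" using dec(5) fin by simp
    then have "model (\<lambda>_. {}) V1 (edge_rel E1) {} S" using True by (simp add: model_def edge_rel_def)
    moreover have "r \<le> c + 1"
    proof -
      have "real r \<le> 2 * q" using r qq(2) by linarith
      also have "\<dots> \<le> 6929 / 1000 * q" using iq by simp
      also have "\<dots> \<le> real c" unfolding c_def qq(1) by linarith
      finally show ?thesis by simp
    qed
    ultimately show thesis using that[of "{}" "\<lambda>_. {}"] by simp
  next
    case False
    define L where "L = D - X"
    define TL where "TL = T \<inter> L \<times> L"
    have TL: "rgraph L TL" unfolding TL_def using T by (rule rgraph_restrict) (auto simp: L_def)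
    have XD: "X \<subseteq> D" using \<phi>(2) by (simp add: X_def)
    have cL: "card L = card D - r" unfolding L_def using XD finX cX by (simp add: card_Diff_subset)
    have rD: "r < card D"
    proof -
      have "card (T `` {v}) < card D" using T by (rule card_nbrs_less) (simp add: D_def)
      moreover have "K < real (card (T `` {v}))" using degD[of v] by (simp add: D_def)
      ultimately show ?thesis using rK by linarith
    qed
    then have "L \<noteq> {}" using cL by auto
    moreover have "K - real r \<le> real (card (TL `` {a}))" if a: "a \<in> L" for a
    proof -
      have "T `` {a} - X \<subseteq> TL `` {a}" unfolding TL_def L_def using a T by (auto simp: L_def dest: rgraph_inD)
      then have "card (T `` {a} - X) \<le> card (TL `` {a})"
        using rgraph_finite_nbrs[OF TL] by (rule card_mono[rotated])
      moreover have "card (T `` {a}) - card X \<le> card (T `` {a} - X)" using finX by (rule diff_card_le_card_Diff)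
      moreover have "K < real (card (T `` {a}))" using degD a by (simp add: L_def)
      ultimately show ?thesis using cX by linarith
    qed
    moreover have "real (card L) \<le> 2 * K + 1 - real r" using cL cD rD by (simp add: of_nat_diff)
    ultimately obtain M B1 where "M \<subseteq> L" "card M + r \<le> c + 1" "model B1 V1 (edge_rel E1) M TL"
      using model_in_dense_part[OF TL _ dec(4,5) False r Kq[unfolded qq(1)]] unfolding c_def by blast
    moreover from this(3) have "model B1 V1 (edge_rel E1) M S"
      by (rule model_mono) (auto simp: TL_def T_def)
    ultimately show thesis using that unfolding L_def by blast
  qed
  have finM: "finite M" using M(1) finD finite_subset by blast
  define Z where "Z = W - (M \<union> X)"
  have MXW: "M \<union> X \<subseteq> W" using M(1) DW \<phi>(2) by (auto simp: X_def)
  have MX: "M \<inter> X = {}" using M(1) by auto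
  have "card (M \<union> X) \<le> c + 1" using card_Un_disjoint[OF finM finX MX] cX M(2) by simp
  \<comment> \<open>Since \<open>h - 1 \<ge> 2 * K \<ge> \<kappa>0\<close> and \<open>card W\<close>
    is an integer, \<open>6.929 * q\<close> may be rounded up for free.\<close>
  moreover have "c + 1 + card I \<le> card W"
  proof -
    have "6929 / 1000 * q \<le> real_of_int (int (card W) - 1 - int (card I))"
      using K Kh unfolding \<kappa>0_def i_def h_def by simp
    then have "\<lceil>6929 / 1000 * q\<rceil> \<le> int (card W) - 1 - int (card I)" by (simp only: ceiling_le_iff)
    moreover have "0 \<le> \<lceil>6929 / 1000 * q\<rceil>" using iq by (simp add: le_ceiling_iff)
    ultimately show ?thesis unfolding c_def qq(1)[symmetric] by linarith
  qed
  moreover have "card Z = card W - card (M \<union> X)"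
    unfolding Z_def using MXW finM finX by (intro card_Diff_subset) auto
  ultimately have "card I \<le> card Z" by linarith
  moreover have "finite Z" using S by (simp add: Z_def rgraph_def)
  ultimately obtain f where f: "inj_on f I" "f ` I \<subseteq> Z" using card_le_inj[OF finI] by blast
  then have mI: "model (\<lambda>x. {f x}) I {} Z S" by (intro model_singletons) auto
  have e1: "edge_rel E1 \<subseteq> V1 \<times> V1" using rgraph_edge_rel[OF dec(4)] by (simp add: rgraph_def)
  have e2: "edge_rel E2 \<subseteq> V2 \<times> V2" using rgraph_edge_rel[OF g2] by (simp add: rgraph_def)
  obtain B2 where B2: "model B2 (V1 \<union> V2) (edge_rel E1 \<union> edge_rel E2) (M \<union> X) S"
    using model_Un[OF m1 m2 MX dec(2) e1 e2] by blast
  have "(M \<union> X) \<inter> Z = {}" "(V1 \<union> V2) \<inter> I = {}" using dec(1) by (auto simp: Z_def)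
  moreover have "edge_rel E1 \<union> edge_rel E2 \<subseteq> (V1 \<union> V2) \<times> (V1 \<union> V2)" using e1 e2 by blast
  ultimately obtain B3 where B3: "model B3 (V1 \<union> V2 \<union> I) (edge_rel E1 \<union> edge_rel E2 \<union> {}) (M \<union> X \<union> Z) S"
    using model_Un[OF B2 mI] by blast
  have "V1 \<union> V2 \<union> I = VH" using dec(1) I by auto
  moreover have "edge_rel E1 \<union> edge_rel E2 \<union> {} = edge_rel EH" using dec(3) by (auto simp: edge_rel_def)
  moreover have "M \<union> X \<union> Z = W" using MXW by (auto simp: Z_def)
  ultimately have "model B3 VH (edge_rel EH) W S" using B3 by simp
  moreover have "edge_rel EH \<subseteq> VH \<times> VH" using rgraph_edge_rel[OF H(1)] by (simp add: rgraph_def)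
  ultimately show thesis using model_trans[OF _ B0] that by blast
qed

theorem theorem15:
  fixes VH :: "'b set" and EH :: "'b set set" and VG :: "'a set" and EG :: "'a set set"
  assumes "graph VH EH" and "graph VG EG"
    and "average_degree VG EG \<ge> real (card (isolated_vertices VH EH)) + 6.929 * real (card EH)"
  shows "is_minor VH EH VG EG"
proof -
  note R = rgraph_edge_rel[OF assms(2)]
  have "\<exists>B. model B VH (edge_rel EH) VG (edge_rel EG)"
  \<comment> \<open>For empty \<open>H\<close> the assumption also admits an empty \<open>G\<close>,
    whose average degree is \<open>0 / 0 = 0\<close>.\<close>
  proof (cases "VH = {}")
    case True
    then have "EH = {}" using assms(1) by (fastforce simp: graph_def)
    then show ?thesis using True by (simp add: model_def edge_rel_def)
  next
    case False
    define d where "d = real (card (isolated_vertices VH EH)) + 6929 / 1000 * real (card EH)"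
    have sum: "(\<Sum>v\<in>VG. degree EG v) = card (edge_rel EG)"
      using card_rgraph_eq_sum[OF R] card_edge_rel_nbrs[OF assms(2)] by simp
    have avg: "d \<le> real (card (edge_rel EG)) / real (card VG)"
      using assms(3) unfolding average_degree_def sum d_def by simp
    have d: "d > 0"
    proof (cases "EH = {}")
      case True
      then have "isolated_vertices VH EH = VH" by (auto simp: isolated_vertices_def)
      then have "card (isolated_vertices VH EH) > 0" using False assms(1) by (simp add: graph_def card_gt_0_iff)
      then show ?thesis unfolding d_def by simp
    next
      case False
      then have "card EH > 0" using finite_edges[OF assms(1)] by (simp add: card_gt_0_iff)
      then show ?thesis unfolding d_def by simp
    qed
    \<comment> \<open>By the same convention for division, an empty \<open>G\<close> contradicts
      \<open>d > 0\<close>.\<close>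
    then have "card VG > 0" using avg by (cases "card VG = 0") auto
    then have "d * real (card VG) \<le> real (card (edge_rel EG))" "VG \<noteq> {}"
      using avg by (auto simp: le_divide_eq)
    then show ?thesis using model_of_average_degree[OF assms(1) d[unfolded d_def] R] unfolding d_def by blast
  qed
  then show ?thesis using model_imp_is_minor[OF assms(1,2)] by blast
qed

end
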